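(* (1) Let $k\ge 0$ and $i\in\{0,1,2,3\}$ be integers with $4k+i\ge1$. Then $I(M_{2,4k+i})$ has the same simple homotopy type as $$\begin{cases} \Diamond^{2k-1} & (i=0),\\ \Diamond^{2k} & (i=1),\\ \bigvee_3\Diamond^{2k} & (i=2),\\ \Diamond^{2k} & (i=3).\end{cases}$$ (2) Let $k\ge 0$ and $i\in\{0,1,\dots,7\}$ be integers with $8k+i\ge1$. Then $I(M_{3,8k+i})$ has the same simple homotopy type as $$\begin{cases} \bigvee_3 \Diamond^{6k-1} & (i=0),\\ \Diamond^{6k} & (i=1,2),\\ \Diamond^{6k+2} & (i=3),\\ \bigvee_5\Diamond^{6k+2} & (i=4),\\ \Diamond^{6k+2} & (i=5),\\ \Diamond^{6k+4} & (i=6,7).\end{cases}$$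
   Context: Graphs are finite and undirected; loops and multiple edges are allowed. The planar square grid graph $P_{m,n}$ has vertex set $\{1,\dots,m\}\times\{1,\dots,n\}$, with $(i_1,j_1)$ and $(i_2,j_2)$ adjacent if and only if they differ by exactly $1$ in one coordinate and agree in the other. For $m,n\ge1$, $M_{m,n}$ is the graph obtained from $P_{m,n+1}$ by identifying the vertices $(i,1)$ and $(m-i+1,n+1)$ for $i=1,\dots,m$ and the corresponding edges (edge $(i,1)(i+1,1)$ with edge $(m-i+1,n+1)(m-i,n+1)$). An independent set of a graph is a set of vertices no two of which are joined by an edge (a vertex carrying a loop belongs to no independent set). The independence complex $I(G)$ is the simplicial complex whose simplices are the independent sets of $G$ (including the empty set $\emptyset$). $\Diamond^n$ is the join of $n+1$ copies of $\partial\Delta^1$ (two points), a triangulation of the $n$-sphere. $\bigvee_r K$ is the wedge sum of $r$ copies of $K$, obtained from their disjoint union by identifying one vertex from each copy to a single vertex. An elementary collapse of a simplicial complex removes a pair of simplices $\sigma\subsetneq\tau$, with $\sigma$ nonempty, $\dim\tau=\dim\sigma+1$, and $\tau$ the only simplex properly containing $\sigma$; an elementary expansion is the inverse operation. Two finite simplicial complexes have the same simple homotopy type if they are connected, up to simplicial isomorphism, by a finite sequence of elementary collapses and elementary expansions. *)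

theory Defs
  imports Main
begin

section \<open>Graphs with loops and multiple edges\<close>

text \<open>The set \<open>ends G e\<close> consists of the end vertices of the edge \<open>e\<close>; it is a singleton
  if \<open>e\<close> is a loop. Distinct edges may have the same ends.\<close>

record ('v, 'e) multigraph =
  verts :: "'v set"
  edges :: "'e set"
  ends :: "'e \<Rightarrow> 'v set"

definition joined :: "('v, 'e) multigraph \<Rightarrow> 'v \<Rightarrow> 'v \<Rightarrow> bool" where
  "joined G u v \<longleftrightarrow> (\<exists>e\<in>edges G. ends G e = {u, v})"

text \<open>Taking \<open>u = v\<close> below excludes the vertices that carry a loop.\<close>

definition independent :: "('v, 'e) multigraph \<Rightarrow> 'v set \<Rightarrow> bool" where
  "independent G S \<longleftrightarrow> S \<subseteq> verts G \<and> (\<forall>u\<in>S. \<forall>v\<in>S. \<not> joined G u v)"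

definition independence_complex :: "('v, 'e) multigraph \<Rightarrow> 'v set set" where
  "independence_complex G = {S. independent G S}"

text \<open>The equivalence relation generated by \<open>r\<close>. It is reflexive on the whole type, but for
  \<open>r \<subseteq> V \<times> V\<close> the classes of elements of \<open>V\<close> stay inside \<open>V\<close>, so that
  \<open>V // generated_equiv r\<close> is the set \<open>V\<close> with the pairs in \<open>r\<close> identified.\<close>

definition generated_equiv :: "('a \<times> 'a) set \<Rightarrow> ('a \<times> 'a) set" where
  "generated_equiv r = (r \<union> r\<inverse>)\<^sup>*"

text \<open>Vertices related by \<open>r\<close> and edges related by \<open>s\<close> are identified. The ends of an edge
  class are the classes of the ends of its members; this is meaningful when edges related by
  \<open>s\<close> have the same ends up to \<open>r\<close>.\<close>

definition identify ::
    "('v, 'e) multigraph \<Rightarrow> ('v \<times> 'v) set \<Rightarrow> ('e \<times> 'e) set \<Rightarrow> ('v set, 'e set) multigraph" where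
  "identify G r s =
    \<lparr>verts = verts G // generated_equiv r,
     edges = edges G // generated_equiv s,
     ends = (\<lambda>C. {generated_equiv r `` {v} | v e. e \<in> C \<and> v \<in> ends G e})\<rparr>"

definition grid_adjacent :: "nat \<times> nat \<Rightarrow> nat \<times> nat \<Rightarrow> bool" where
  "grid_adjacent u v \<longleftrightarrow>
    (fst u = fst v \<and> (snd u = snd v + 1 \<or> snd v = snd u + 1)) \<or>
    (snd u = snd v \<and> (fst u = fst v + 1 \<or> fst v = fst u + 1))"

definition grid_graph :: "nat \<Rightarrow> nat \<Rightarrow> (nat \<times> nat, (nat \<times> nat) set) multigraph" where
  "grid_graph m n =
    \<lparr>verts = {1..m} \<times> {1..n},
     edges = {{u, v} | u v. u \<in> {1..m} \<times> {1..n} \<and> v \<in> {1..m} \<times> {1..n} \<and> grid_adjacent u v},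
     ends = (\<lambda>e. e)\<rparr>"

definition moebius_grid ::
    "nat \<Rightarrow> nat \<Rightarrow> ((nat \<times> nat) set, (nat \<times> nat) set set) multigraph" where
  "moebius_grid m n =
    identify (grid_graph m (n + 1))
      {((i, 1), (m - i + 1, n + 1)) | i. 1 \<le> i \<and> i \<le> m}
      {({(i, 1), (i + 1, 1)}, {(m - i + 1, n + 1), (m - i, n + 1)}) | i. 1 \<le> i \<and> i < m}"

section \<open>Simplicial complexes\<close>

text \<open>A complex is the set of its simplices, including the empty one; its vertex set is its
  union.\<close>

definition finite_simplicial_complex :: "'a set set \<Rightarrow> bool" where
  "finite_simplicial_complex K \<longleftrightarrow>
    finite K \<and> {} \<in> K \<and> (\<forall>\<sigma>\<in>K. finite \<sigma>) \<and> (\<forall>\<sigma>\<in>K. \<forall>\<tau>. \<tau> \<subseteq> \<sigma> \<longrightarrow> \<tau> \<in> K)"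

definition simplicial_iso :: "'a set set \<Rightarrow> 'b set set \<Rightarrow> bool" where
  "simplicial_iso K L \<longleftrightarrow> (\<exists>f. bij_betw f (\<Union>K) (\<Union>L) \<and> (\<lambda>\<sigma>. f ` \<sigma>) ` K = L)"

definition elementary_collapse :: "'a set set \<Rightarrow> 'a set set \<Rightarrow> bool" where
  "elementary_collapse K L \<longleftrightarrow>
    finite_simplicial_complex K \<and>
    (\<exists>\<sigma>\<in>K. \<exists>\<tau>\<in>K. \<sigma> \<noteq> {} \<and> \<sigma> \<subset> \<tau> \<and> card \<tau> = card \<sigma> + 1 \<and>
      (\<forall>\<rho>\<in>K. \<sigma> \<subset> \<rho> \<longrightarrow> \<rho> = \<tau>) \<and> L = K - {\<sigma>, \<tau>})"

text \<open>The intermediate complexes have their vertices in \<open>nat\<close>. Every finite complex has a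
  copy there, with infinitely many vertices left for expansions. As \<open>equivclp\<close> is the
  generated equivalence relation, steps in the reverse direction, that is elementary expansions,
  are included.\<close>

definition same_simple_homotopy_type :: "'a set set \<Rightarrow> 'b set set \<Rightarrow> bool" where
  "same_simple_homotopy_type K L \<longleftrightarrow>
    finite_simplicial_complex K \<and> finite_simplicial_complex L \<and>
    (\<exists>K' L' :: nat set set. simplicial_iso K K' \<and> simplicial_iso L L' \<and>
      equivclp (\<lambda>A B. simplicial_iso A B \<or> elementary_collapse A B) K' L')"

definition join_copies :: "nat \<Rightarrow> 'a set set \<Rightarrow> (nat \<times> 'a) set set" where
  "join_copies r K = {Sigma {..<r} f | f. \<forall>j<r. f j \<in> K}"

definition simplex_boundary :: "nat \<Rightarrow> nat set set" where
  "simplex_boundary n = {\<sigma>. \<sigma> \<subset> {0..n}}"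

definition diamond :: "nat \<Rightarrow> (nat \<times> nat) set set" where
  "diamond n = join_copies (n + 1) (simplex_boundary 1)"

text \<open>The wedge of \<open>r \<ge> 1\<close> copies of \<open>K\<close> with respect to the base vertices \<open>b 0\<close>, ...,
  \<open>b (r - 1)\<close> of the copies: \<open>None\<close> is the common vertex, and \<open>Some (j, v)\<close> is the vertex
  \<open>v \<noteq> b j\<close> of the \<open>j\<close>-th copy.\<close>

definition wedge_copies :: "nat \<Rightarrow> (nat \<Rightarrow> 'a) \<Rightarrow> 'a set set \<Rightarrow> (nat \<times> 'a) option set set" where
  "wedge_copies r b K =
    {(\<lambda>v. if v = b j then None else Some (j, v)) ` \<sigma> | j \<sigma>. j < r \<and> \<sigma> \<in> K}"

text \<open>A wedge of copies of \<open>L\<close> is only determined once the vertices to be identified are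
  chosen; the statement is required for every choice.\<close>

definition same_simple_homotopy_type_as_wedge :: "'a set set \<Rightarrow> nat \<Rightarrow> 'b set set \<Rightarrow> bool" where
  "same_simple_homotopy_type_as_wedge K r L \<longleftrightarrow>
    (\<forall>b. (\<forall>j<r. b j \<in> \<Union>L) \<longrightarrow> same_simple_homotopy_type K (wedge_copies r b L))"

end

theory Submission
  imports Defs
begin

text \<open>If the link of a nonempty simplex collapses to the void complex, then the open star of the
  simplex can be collapsed away. For independence complexes this makes it possible to delete a vertex
  \<open>x\<close>, and to insert or delete an edge \<open>uv\<close>, whenever the graph without the closed neighbourhood of
  \<open>x\<close>, respectively of \<open>u\<close> and \<open>v\<close>, dismantles to a graph with an isolated vertex. A component that
  is a single edge accounts for a suspension, and a complete component on \<open>r + 1\<close> vertices for a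
  wedge of \<open>r\<close> spheres.

  Consider \<open>w + 2\<close> consecutive columns of the grid, where \<open>w = 2\<close> for \<open>m = 2\<close> and \<open>w = 4\<close> for
  \<open>m = 3\<close>. Moves of this kind join the vertex \<open>i\<close> of the first column to the vertex \<open>m + 1 - i\<close> of the
  last one and then cut off the inner \<open>w\<close> columns, which in turn reduce to one or three disjoint
  edges. So \<open>w\<close> columns may be removed at the price of one or three suspensions and of exchanging the
  Moebius band with the annulus. Doing this twice gives the periodicity, and finitely many small
  grids remain.\<close>

section \<open>Collapsing the star of a simplex\<close>

text \<open>Every reduction is a move on a graph given by a list of edges, so a certificate is
  checked by evaluation and no complex is ever enumerated. The obstacle is that a window lies in a
  band of arbitrary length: a move at its border also affects neighbours that are not listed.
  Certificates remain valid because only inner vertices, all of whose neighbours are listed, may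
  dominate another vertex or end up isolated.

  A window needs two distinct border columns, so a band is shortened only to two or more columns. A
  single column stands apart, and its residue class restarts at 5 or 9 columns, from annuli with 3
  or 5 columns.

  The normal form is the join of \<open>r + 1\<close> points with \<open>d\<close> copies of the
  0-sphere, which has the homotopy type of a wedge of \<open>r\<close> spheres of dimension
  \<open>d\<close>. A suspension of a wedge is not literally a wedge, whereas the joins are closed
  under suspension and arise directly from complete graphs and isolated edges. The passage to actual
  wedges, with arbitrary base vertices, is made once for all.\<close>

text \<open>Here \<open>\<sigma>\<close> may be empty, so that a cone collapses to the void complex \<open>{}\<close>.\<close>

definition augmented_collapse :: "'a set set \<Rightarrow> 'a set set \<Rightarrow> bool" where
  "augmented_collapse K L \<longleftrightarrow>
    (\<exists>\<sigma>\<in>K. \<exists>\<tau>\<in>K. \<sigma> \<subset> \<tau> \<and> card \<tau> = card \<sigma> + 1 \<and>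
      (\<forall>\<rho>\<in>K. \<sigma> \<subset> \<rho> \<longrightarrow> \<rho> = \<tau>) \<and> L = K - {\<sigma>, \<tau>})"

text \<open>For a simplicial complex this is collapsibility to a point, followed by the removal of
  the last pair, a vertex and the empty simplex.\<close>

definition vanishes :: "'a set set \<Rightarrow> bool" where
  "vanishes K \<longleftrightarrow> augmented_collapse\<^sup>*\<^sup>* K {}"

lemma finite_simplicial_complex_elementary_collapse:
  assumes "elementary_collapse K L"
  shows "finite_simplicial_complex K" "finite_simplicial_complex L"
proof -
  show K: "finite_simplicial_complex K"
    using assms by (simp add: elementary_collapse_def)
  obtain \<sigma> \<tau> where st: "\<sigma> \<in> K" "\<tau> \<in> K" "\<sigma> \<noteq> {}" "\<sigma> \<subset> \<tau>" and L: "L = K - {\<sigma>, \<tau>}"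
    and free: "\<And>\<rho>. \<rho> \<in> K \<Longrightarrow> \<sigma> \<subset> \<rho> \<Longrightarrow> \<rho> = \<tau>"
    using assms unfolding elementary_collapse_def by blast
  have "\<pi> \<in> L" if "\<rho> \<in> L" "\<pi> \<subseteq> \<rho>" for \<rho> \<pi>
  proof -
    have "\<rho> \<in> K" "\<rho> \<noteq> \<sigma>" "\<rho> \<noteq> \<tau>" using that L by auto
    moreover have "\<pi> \<in> K" using K \<open>\<rho> \<in> K\<close> that unfolding finite_simplicial_complex_def by blast
    ultimately show ?thesis using L free that st by blast
  qed
  moreover have "finite L" "{} \<in> L" "\<And>\<sigma>. \<sigma> \<in> L \<Longrightarrow> finite \<sigma>"
    using K st(3,4) by (auto simp: L finite_simplicial_complex_def)
  ultimately show "finite_simplicial_complex L"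
    unfolding finite_simplicial_complex_def by blast
qed

text \<open>Above a maximal simplex \<open>\<sigma>\<close> avoiding \<open>w\<close> there is only
  \<open>insert w \<sigma>\<close>, so this pair can be removed. Closure under inserting and
  deleting \<open>w\<close>, instead of closure under subsets, is the invariant that each removal
  keeps.\<close>

lemma vanishes_cone:
  assumes "finite K" "\<And>\<sigma>. \<sigma> \<in> K \<Longrightarrow> finite \<sigma>" "\<And>\<sigma>. \<sigma> \<in> K \<Longrightarrow> insert w \<sigma> \<in> K"
    "\<And>\<sigma>. \<sigma> \<in> K \<Longrightarrow> \<sigma> - {w} \<in> K"
  shows "vanishes K"
  using assms
proof (induction "card K" arbitrary: K rule: less_induct)
  case less
  show ?case
  proof (cases "K = {}")
    case True
    then show ?thesis by (simp add: vanishes_def)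
  next
    case False
    define K0 where "K0 = {\<sigma>\<in>K. w \<notin> \<sigma>}"
    have "finite K0" "K0 \<noteq> {}"
      using less.prems False by (auto simp: K0_def)
    then obtain \<sigma> where s: "\<sigma> \<in> K0" "\<And>\<rho>. \<rho> \<in> K0 \<Longrightarrow> \<sigma> \<subseteq> \<rho> \<Longrightarrow> \<rho> = \<sigma>"
      using finite_has_maximal[of K0] by metis
    have sK: "\<sigma> \<in> K" "w \<notin> \<sigma>" "insert w \<sigma> \<in> K" "finite \<sigma>"
      using s less.prems by (auto simp: K0_def)
    have free: "\<rho> = insert w \<sigma>" if "\<rho> \<in> K" "\<sigma> \<subset> \<rho>" for \<rho>
    proof -
      have "\<rho> - {w} \<in> K0" using less.prems that by (auto simp: K0_def)
      moreover have "\<sigma> \<subseteq> \<rho> - {w}" using that sK by auto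
      ultimately have "\<rho> - {w} = \<sigma>" using s by blast
      then show ?thesis using that by auto
    qed
    define K' where "K' = K - {\<sigma>, insert w \<sigma>}"
    have "vanishes K'"
    proof (rule less.hyps)
      show "card K' < card K"
        using less.prems sK by (intro psubset_card_mono) (auto simp: K'_def)
      show "insert w \<rho> \<in> K'" if "\<rho> \<in> K'" for \<rho>
      proof -
        have "insert w \<rho> \<noteq> insert w \<sigma>"
        proof
          assume a: "insert w \<rho> = insert w \<sigma>"
          then have "\<rho> = \<sigma> \<or> \<rho> = insert w \<sigma>" using sK by (cases "w \<in> \<rho>") auto
          then show False using that by (auto simp: K'_def)
        qed
        then show ?thesis using that less.prems(3) sK by (auto simp: K'_def)
      qed
      show "\<rho> - {w} \<in> K'" if "\<rho> \<in> K'" for \<rho>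
      proof -
        have "\<rho> - {w} \<noteq> \<sigma>"
        proof
          assume a: "\<rho> - {w} = \<sigma>"
          then have "\<rho> = \<sigma> \<or> \<rho> = insert w \<sigma>" by auto
          then show False using that by (auto simp: K'_def)
        qed
        then show ?thesis using that less.prems(4) sK by (auto simp: K'_def)
      qed
    qed (use less.prems in \<open>auto simp: K'_def\<close>)
    moreover have "augmented_collapse K K'"
      unfolding augmented_collapse_def K'_def
      by (rule bexI[of _ \<sigma>], rule bexI[of _ "insert w \<sigma>"]) (use sK free in auto)
    ultimately show ?thesis
      by (auto simp: vanishes_def intro: converse_rtranclp_into_rtranclp)
  qed
qed

text \<open>A free pair of the link becomes a free pair of \<open>K\<close> by adding
  \<open>s\<close> to both members. The smaller member is then nonempty even if it was the empty
  simplex, so an augmented collapse of the link turns into an elementary one. The equation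
  \<open>M = {}\<close> leaves the end of the chain a variable for the induction.\<close>

lemma star_collapse_aux:
  assumes "augmented_collapse\<^sup>*\<^sup>* L M" "M = {}" "finite_simplicial_complex K" "s \<noteq> {}" "finite s"
    "L = {\<rho>. \<rho> \<inter> s = {} \<and> \<rho> \<union> s \<in> K}"
  shows "elementary_collapse\<^sup>*\<^sup>* K {\<sigma>\<in>K. \<not> s \<subseteq> \<sigma>}"
  using assms
proof (induction arbitrary: K rule: converse_rtranclp_induct)
  case base
  have "\<not> s \<subseteq> \<sigma>" if "\<sigma> \<in> K" for \<sigma>
  proof
    assume "s \<subseteq> \<sigma>"
    then have "(\<sigma> - s) \<inter> s = {}" "(\<sigma> - s) \<union> s = \<sigma>" by auto
    then have "\<sigma> - s \<in> M" using base that by auto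
    then show False using base by simp
  qed
  then have "{\<sigma>\<in>K. \<not> s \<subseteq> \<sigma>} = K" by auto
  then show ?case by simp
next
  case (step L L1)
  obtain \<sigma> \<tau> where st: "\<sigma> \<in> L" "\<tau> \<in> L" "\<sigma> \<subset> \<tau>" "card \<tau> = card \<sigma> + 1"
    and free: "\<And>\<rho>. \<rho> \<in> L \<Longrightarrow> \<sigma> \<subset> \<rho> \<Longrightarrow> \<rho> = \<tau>" and L1: "L1 = L - {\<sigma>, \<tau>}"
    using step.hyps(1) unfolding augmented_collapse_def by blast
  note L = step.prems(5)
  have stK: "\<sigma> \<union> s \<in> K" "\<tau> \<union> s \<in> K" "\<sigma> \<inter> s = {}" "\<tau> \<inter> s = {}" using st L by auto
  have fin: "finite \<sigma>" "finite \<tau>"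
    using stK step.prems(2) unfolding finite_simplicial_complex_def by (metis finite_Un)+
  define K1 where "K1 = K - {\<sigma> \<union> s, \<tau> \<union> s}"
  have sub: "\<sigma> \<union> s \<subset> \<tau> \<union> s" using st stK by blast
  have crd: "card (\<tau> \<union> s) = card (\<sigma> \<union> s) + 1"
    using st stK fin step.prems by (simp add: card_Un_disjoint)
  have unq: "\<rho> = \<tau> \<union> s" if r: "\<rho> \<in> K" "\<sigma> \<union> s \<subset> \<rho>" for \<rho>
  proof -
    have e: "(\<rho> - s) \<union> s = \<rho>" using r by blast
    then have "\<rho> - s \<in> L" using r L by auto
    moreover have "\<sigma> \<subset> \<rho> - s" using r stK by blast
    ultimately have "\<rho> - s = \<tau>" using free by blast
    then show ?thesis using e by simp
  qed
  have col: "elementary_collapse K K1"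
    unfolding elementary_collapse_def
    by (rule conjI[OF step.prems(2)], rule bexI[OF _ stK(1)], rule bexI[OF _ stK(2)])
      (simp add: sub crd unq step.prems(3) K1_def)
  have "elementary_collapse\<^sup>*\<^sup>* K1 {\<sigma>\<in>K1. \<not> s \<subseteq> \<sigma>}"
  proof (rule step.IH)
    have "\<rho> \<union> s = \<sigma> \<union> s \<longleftrightarrow> \<rho> = \<sigma>" "\<rho> \<union> s = \<tau> \<union> s \<longleftrightarrow> \<rho> = \<tau>" if "\<rho> \<inter> s = {}" for \<rho>
      using that stK by blast+
    then show "L1 = {\<rho>. \<rho> \<inter> s = {} \<and> \<rho> \<union> s \<in> K1}"
      unfolding L1 L K1_def by auto
  qed (fact step.prems finite_simplicial_complex_elementary_collapse[OF col])+
  moreover have "{\<sigma>\<in>K1. \<not> s \<subseteq> \<sigma>} = {\<sigma>\<in>K. \<not> s \<subseteq> \<sigma>}"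
    by (auto simp: K1_def)
  ultimately show ?case using converse_rtranclp_into_rtranclp[of elementary_collapse, OF col] by simp
qed

lemma star_collapse:
  assumes "finite_simplicial_complex K" "s \<noteq> {}" "finite s"
    "vanishes {\<rho>. \<rho> \<inter> s = {} \<and> \<rho> \<union> s \<in> K}"
  shows "elementary_collapse\<^sup>*\<^sup>* K {\<sigma>\<in>K. \<not> s \<subseteq> \<sigma>}"
  using star_collapse_aux[OF _ refl assms(1-3) refl] assms(4) by (simp add: vanishes_def)

section \<open>Independence complexes of relations\<close>

definition ind :: "'a set \<Rightarrow> ('a \<Rightarrow> 'a \<Rightarrow> bool) \<Rightarrow> 'a set set" where
  "ind V E = {S. S \<subseteq> V \<and> (\<forall>u\<in>S. \<forall>v\<in>S. \<not> E u v)}"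

lemma ind_cong: "V = V' \<Longrightarrow> (\<And>u v. u \<in> V' \<Longrightarrow> v \<in> V' \<Longrightarrow> E u v = E' u v) \<Longrightarrow> ind V E = ind V' E'"
  unfolding ind_def by blast

lemma finite_simplicial_complex_ind: "finite V \<Longrightarrow> finite_simplicial_complex (ind V E)"
  unfolding finite_simplicial_complex_def ind_def
  by (auto intro: finite_subset)

text \<open>Inserting or deleting \<open>w\<close> preserves independence, so the complex is a cone
  with apex \<open>w\<close>.\<close>

lemma vanishes_ind_isolated:
  assumes "finite H" "w \<in> H" "symp E" "\<And>y. y \<in> H \<Longrightarrow> \<not> E w y"
  shows "vanishes (ind H E)"
proof (rule vanishes_cone[of _ w])
  show "finite (ind H E)" "\<And>\<sigma>. \<sigma> \<in> ind H E \<Longrightarrow> finite \<sigma>"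
    using finite_simplicial_complex_ind[OF assms(1), of E]
    by (auto simp: finite_simplicial_complex_def)
  show "\<And>\<sigma>. \<sigma> \<in> ind H E \<Longrightarrow> insert w \<sigma> \<in> ind H E"
    using assms by (auto simp: ind_def dest: sympD)
qed (auto simp: ind_def)

lemma link_ind_vertex:
  assumes "symp E" "x \<in> V" "\<not> E x x"
  shows "{\<rho>. \<rho> \<inter> {x} = {} \<and> \<rho> \<union> {x} \<in> ind V E} = ind {y\<in>V. y \<noteq> x \<and> \<not> E x y} E"
  using assms unfolding ind_def by (auto dest: sympD)

text \<open>The link of \<open>x\<close> is the independence complex of its non-neighbours, and
  removing the open star of \<open>x\<close> leaves the independent sets that avoid
  \<open>x\<close>. If \<open>x\<close> is absent or carries a loop, no simplex contains it.\<close>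

lemma ind_drop_vertex:
  assumes "finite V" "symp E" "vanishes (ind {y\<in>V. y \<noteq> x \<and> \<not> E x y} E)"
  shows "elementary_collapse\<^sup>*\<^sup>* (ind V E) (ind (V - {x}) E)"
proof (cases "x \<in> V \<and> \<not> E x x")
  case True
  have "elementary_collapse\<^sup>*\<^sup>* (ind V E) {\<sigma>\<in>ind V E. \<not> {x} \<subseteq> \<sigma>}"
    using assms True
    by (intro star_collapse finite_simplicial_complex_ind)
      (simp_all only: link_ind_vertex not_False_eq_True finite.intros insert_not_empty)
  moreover have "{\<sigma>\<in>ind V E. \<not> {x} \<subseteq> \<sigma>} = ind (V - {x}) E" by (auto simp: ind_def)
  ultimately show ?thesis by simp
next
  case False
  then have "ind V E = ind (V - {x}) E" by (auto simp: ind_def)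
  then show ?thesis by simp
qed

lemma ind_add_edge:
  assumes "finite V" "symp E" "u \<noteq> v"
    "vanishes (ind {y\<in>V. y \<noteq> u \<and> y \<noteq> v \<and> \<not> E u y \<and> \<not> E v y} E)"
  shows "elementary_collapse\<^sup>*\<^sup>* (ind V E)
    (ind V (\<lambda>x y. E x y \<or> x = u \<and> y = v \<or> x = v \<and> y = u))"
    (is "_\<^sup>*\<^sup>* _ (ind V ?E)")
proof (cases "u \<in> V \<and> v \<in> V \<and> \<not> E u v \<and> \<not> E u u \<and> \<not> E v v")
  case True
  have "{\<rho>. \<rho> \<inter> {u, v} = {} \<and> \<rho> \<union> {u, v} \<in> ind V E} =
      ind {y\<in>V. y \<noteq> u \<and> y \<noteq> v \<and> \<not> E u y \<and> \<not> E v y} E"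
    using True assms(2) unfolding ind_def by (auto dest: sympD)
  then have "elementary_collapse\<^sup>*\<^sup>* (ind V E) {\<sigma>\<in>ind V E. \<not> {u, v} \<subseteq> \<sigma>}"
    using assms by (intro star_collapse finite_simplicial_complex_ind) auto
  moreover have "{\<sigma>\<in>ind V E. \<not> {u, v} \<subseteq> \<sigma>} = ind V ?E" by (auto simp: ind_def)
  ultimately show ?thesis by simp
next
  case False
  then have "ind V E = ind V ?E" using assms(2) by (auto simp: ind_def dest: sympD)
  then show ?thesis by simp
qed

lemma vanishes_trans:
  assumes "elementary_collapse\<^sup>*\<^sup>* K L" "vanishes L"
  shows "vanishes K"
proof -
  have "augmented_collapse\<^sup>*\<^sup>* K L"
    using assms(1)
    by (rule rtranclp_mono[THEN predicate2D, rotated])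
      (force simp: elementary_collapse_def augmented_collapse_def)
  then show ?thesis using assms(2) by (simp add: vanishes_def)
qed

text \<open>All neighbours of \<open>w\<close> are neighbours of \<open>x\<close>, so
  \<open>w\<close> is isolated among the non-neighbours of \<open>x\<close>: the link of
  \<open>x\<close> is a cone.\<close>

lemma vanishes_ind_fold:
  assumes "finite H" "symp E" "w \<in> H" "x \<noteq> w" "\<not> E w x"
    "\<And>y. y \<in> H \<Longrightarrow> E w y \<Longrightarrow> E x y" "vanishes (ind (H - {x}) E)"
  shows "vanishes (ind H E)"
proof (rule vanishes_trans[OF ind_drop_vertex assms(7)])
  show "vanishes (ind {y\<in>H. y \<noteq> x \<and> \<not> E x y} E)"
    by (rule vanishes_ind_isolated[of _ w]) (use assms in \<open>auto dest: sympD\<close>)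
qed (use assms in auto)

section \<open>Simple homotopy type\<close>

lemma simplicial_iso_refl: "simplicial_iso K K"
  unfolding simplicial_iso_def by (rule exI[of _ id]) auto

lemma Union_image_image: "\<Union> ((`) f ` K) = f ` \<Union>K"
  by blast

lemma simplicial_iso_image:
  assumes "inj_on f (\<Union>K)"
  shows "simplicial_iso K ((`) f ` K)"
  unfolding simplicial_iso_def Union_image_image
  using assms by (intro exI[of _ f]) (auto simp: bij_betw_def)

lemma simplicial_iso_sym:
  assumes "simplicial_iso K L"
  shows "simplicial_iso L K"
proof -
  obtain f where f: "bij_betw f (\<Union>K) (\<Union>L)" "(`) f ` K = L"
    using assms by (auto simp: simplicial_iso_def)
  define g where "g = inv_into (\<Union>K) f"
  have "g ` f ` \<sigma> = \<sigma>" if "\<sigma> \<in> K" for \<sigma>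
    unfolding g_def using f(1) that
    by (intro inv_into_image_cancel) (auto simp: bij_betw_def)
  then have "(`) g ` L = K"
    unfolding f(2)[symmetric] image_image by simp
  moreover have "bij_betw g (\<Union>L) (\<Union>K)"
    unfolding g_def using f(1) by (rule bij_betw_inv_into)
  ultimately show ?thesis by (auto simp: simplicial_iso_def)
qed

lemma simplicial_iso_trans:
  assumes "simplicial_iso K L" "simplicial_iso L M"
  shows "simplicial_iso K M"
proof -
  obtain f g where f: "bij_betw f (\<Union>K) (\<Union>L)" "(`) f ` K = L"
    and g: "bij_betw g (\<Union>L) (\<Union>M)" "(`) g ` L = M"
    using assms unfolding simplicial_iso_def by blast
  have "bij_betw (g \<circ> f) (\<Union>K) (\<Union>M)" using f(1) g(1) by (rule bij_betw_trans)
  moreover have "(`) (g \<circ> f) ` K = M"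
    unfolding f(2)[symmetric] g(2)[symmetric] image_image by (simp add: image_comp)
  ultimately show ?thesis unfolding simplicial_iso_def by blast
qed

lemma inj_on_image_Union_eq:
  "inj_on f (\<Union>K) \<Longrightarrow> \<sigma> \<in> K \<Longrightarrow> \<tau> \<in> K \<Longrightarrow> f ` \<sigma> = f ` \<tau> \<longleftrightarrow> \<sigma> = \<tau>"
  by (meson Union_upper inj_on_image_eq_iff)

lemma finite_simplicial_complex_image:
  assumes "finite_simplicial_complex K"
  shows "finite_simplicial_complex ((`) f ` K)"
proof -
  have "\<tau> \<in> (`) f ` K" if s: "\<sigma> \<in> K" "\<tau> \<subseteq> f ` \<sigma>" for \<sigma> \<tau>
  proof -
    obtain \<rho> where "\<rho> \<subseteq> \<sigma>" "\<tau> = f ` \<rho>" using s(2) by (meson subset_imageE)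
    then show ?thesis using s(1) assms by (auto simp: finite_simplicial_complex_def)
  qed
  then show ?thesis
    using assms by (auto simp: finite_simplicial_complex_def)
qed

lemma finite_simplicial_complex_iso:
  assumes "finite_simplicial_complex K" "simplicial_iso K L"
  shows "finite_simplicial_complex L"
  using assms finite_simplicial_complex_image by (auto simp: simplicial_iso_def)

lemma elementary_collapse_image:
  assumes "elementary_collapse K L" "inj_on f (\<Union>K)"
  shows "elementary_collapse ((`) f ` K) ((`) f ` L)"
proof -
  obtain \<sigma> \<tau> where st: "\<sigma> \<in> K" "\<tau> \<in> K" "\<sigma> \<noteq> {}" "\<sigma> \<subset> \<tau>" "card \<tau> = card \<sigma> + 1"
    and L: "L = K - {\<sigma>, \<tau>}" and free: "\<And>\<rho>. \<rho> \<in> K \<Longrightarrow> \<sigma> \<subset> \<rho> \<Longrightarrow> \<rho> = \<tau>"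
    using assms(1) unfolding elementary_collapse_def by blast
  have K: "finite_simplicial_complex ((`) f ` K)"
    using assms(1) by (simp add: finite_simplicial_complex_elementary_collapse finite_simplicial_complex_image)
  have inj: "inj_on f \<sigma>" "inj_on f \<tau>"
    using st assms(2) by (meson Union_upper inj_on_subset)+
  have crd: "card (f ` \<tau>) = card (f ` \<sigma>) + 1"
    using st inj by (simp add: card_image)
  have sub: "f ` \<sigma> \<subset> f ` \<tau>"
    using st(4) crd by (intro psubsetI) auto
  have unq: "\<rho> = f ` \<tau>" if r: "\<rho> \<in> (`) f ` K" "f ` \<sigma> \<subset> \<rho>" for \<rho>
  proof -
    obtain \<pi> where p: "\<pi> \<in> K" "\<rho> = f ` \<pi>" using r by blast
    have "x \<in> \<pi>" if x: "x \<in> \<sigma>" for x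
    proof -
      obtain y where "y \<in> \<pi>" "f x = f y" using x r(2) p(2) by blast
      then show ?thesis using inj_onD[OF assms(2), of x y] x st(1) p(1) by blast
    qed
    then have "\<sigma> \<subset> \<pi>" using r(2) p(2) by blast
    then show ?thesis using free p by blast
  qed
  have img: "(`) f ` L = (`) f ` K - {f ` \<sigma>, f ` \<tau>}"
    using inj_on_image_Union_eq[OF assms(2)] st unfolding L by blast
  show ?thesis
    unfolding elementary_collapse_def
    by (rule conjI[OF K], rule bexI[OF _ imageI[OF st(1)]], rule bexI[OF _ imageI[OF st(2)]])
      (simp add: sub crd unq st(3) img)
qed

lemma obtain_nat_copy:
  assumes "finite_simplicial_complex (K :: 'a set set)"
  obtains f :: "'a \<Rightarrow> nat" where "inj_on f (\<Union>K)"
proof -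
  have "finite (\<Union>K)" using assms by (auto simp: finite_simplicial_complex_def)
  then show thesis using finite_imp_inj_to_nat_seg that by metis
qed

lemma same_simple_homotopy_typeI:
  fixes K' L' :: "nat set set"
  assumes "finite_simplicial_complex K" "finite_simplicial_complex L"
    "simplicial_iso K K'" "simplicial_iso L L'"
    "equivclp (\<lambda>A B. simplicial_iso A B \<or> elementary_collapse A B) K' L'"
  shows "same_simple_homotopy_type K L"
  using assms unfolding same_simple_homotopy_type_def by blast

lemma same_simple_homotopy_type_finite:
  assumes "same_simple_homotopy_type K L"
  shows "finite_simplicial_complex K" "finite_simplicial_complex L"
  using assms by (auto simp: same_simple_homotopy_type_def)

text \<open>One copy in \<open>nat\<close> serves for both complexes.\<close>

lemma same_simple_homotopy_type_iso:
  assumes "finite_simplicial_complex K" "simplicial_iso K L"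
  shows "same_simple_homotopy_type K L"
proof -
  obtain f :: "'a \<Rightarrow> nat" where f: "inj_on f (\<Union>K)" using assms(1) by (rule obtain_nat_copy)
  let ?K' = "(`) f ` K"
  have K': "simplicial_iso K ?K'" using f by (rule simplicial_iso_image)
  have "simplicial_iso L ?K'"
    using simplicial_iso_trans[OF simplicial_iso_sym[OF assms(2)] K'] .
  then show ?thesis
    by (rule same_simple_homotopy_typeI[OF assms(1) finite_simplicial_complex_iso[OF assms] K'])
      simp
qed

lemma same_simple_homotopy_type_refl:
  "finite_simplicial_complex K \<Longrightarrow> same_simple_homotopy_type K K"
  by (rule same_simple_homotopy_type_iso[OF _ simplicial_iso_refl])

lemma same_simple_homotopy_type_sym:
  assumes "same_simple_homotopy_type K L"
  shows "same_simple_homotopy_type L K"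
proof -
  let ?r = "\<lambda>A B :: nat set set. simplicial_iso A B \<or> elementary_collapse A B"
  obtain K' L' :: "nat set set"
    where "simplicial_iso K K'" "simplicial_iso L L'" "equivclp ?r K' L'"
    using assms unfolding same_simple_homotopy_type_def by blast
  then show ?thesis
    using same_simple_homotopy_type_finite[OF assms]
    by (intro same_simple_homotopy_typeI[of L K L' K'] equivclp_sym[of ?r K' L']) simp_all
qed

text \<open>The two copies of \<open>L\<close> in \<open>nat\<close> may differ, but they are
  isomorphic, and isomorphisms are themselves steps of the generating relation.\<close>

lemma same_simple_homotopy_type_trans [trans]:
  assumes "same_simple_homotopy_type K L" "same_simple_homotopy_type L M"
  shows "same_simple_homotopy_type K M"
proof -
  let ?r = "\<lambda>A B :: nat set set. simplicial_iso A B \<or> elementary_collapse A B"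
  obtain K' L' :: "nat set set"
    where 1: "simplicial_iso K K'" "simplicial_iso L L'" "equivclp ?r K' L'"
    using assms(1) unfolding same_simple_homotopy_type_def by blast
  obtain L'' M' :: "nat set set"
    where 2: "simplicial_iso L L''" "simplicial_iso M M'" "equivclp ?r L'' M'"
    using assms(2) unfolding same_simple_homotopy_type_def by blast
  have "simplicial_iso L' L''"
    using simplicial_iso_trans[OF simplicial_iso_sym[OF 1(2)] 2(1)] .
  then have "equivclp ?r L' L''" by (simp add: r_into_equivclp)
  then have "equivclp ?r K' M'"
    by (rule equivclp_trans[OF equivclp_trans[OF 1(3)] 2(3)])
  then show ?thesis
    using assms by (intro same_simple_homotopy_typeI[OF _ _ 1(1) 2(2)])
      (auto simp: same_simple_homotopy_type_def)
qed

lemma same_simple_homotopy_type_elementary_collapse: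
  assumes "elementary_collapse K L"
  shows "same_simple_homotopy_type K L"
proof -
  note fin = finite_simplicial_complex_elementary_collapse[OF assms]
  obtain f :: "'a \<Rightarrow> nat" where f: "inj_on f (\<Union>K)" using fin(1) by (rule obtain_nat_copy)
  have "L \<subseteq> K" using assms by (auto simp: elementary_collapse_def)
  then have "inj_on f (\<Union>L)" using f by (meson Union_mono inj_on_subset)
  then show ?thesis
    by (intro same_simple_homotopy_typeI[OF fin simplicial_iso_image[OF f] simplicial_iso_image[of f L]]
        r_into_equivclp disjI2 elementary_collapse_image[OF assms f])
qed

lemma same_simple_homotopy_type_collapses:
  assumes "elementary_collapse\<^sup>*\<^sup>* K L" "finite_simplicial_complex K"
  shows "same_simple_homotopy_type K L"
  using assms(1)
proof induction
  case base
  show ?case using assms(2) by (rule same_simple_homotopy_type_refl)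
next
  case (step L M)
  show ?case
    using same_simple_homotopy_type_trans[OF step.IH
        same_simple_homotopy_type_elementary_collapse[OF step.hyps(2)]] .
qed

section \<open>Suspension\<close>

definition suspend :: "'a \<Rightarrow> 'a \<Rightarrow> 'a set set \<Rightarrow> 'a set set" where
  "suspend u v K = K \<union> insert u ` K \<union> insert v ` K"

lemma Union_suspend: "K \<noteq> {} \<Longrightarrow> \<Union>(suspend u v K) = insert u (insert v (\<Union>K))"
  by (auto simp: suspend_def)

lemma finite_simplicial_complex_suspend:
  assumes "finite_simplicial_complex K"
  shows "finite_simplicial_complex (suspend u v K)"
proof -
  have down: "\<tau> \<in> K" if "\<sigma> \<in> K" "\<tau> \<subseteq> \<sigma>" for \<sigma> \<tau>
    using assms that unfolding finite_simplicial_complex_def by blast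
  have cone: "\<tau> \<in> K \<union> insert x ` K" if "\<sigma> \<in> K" "\<tau> \<subseteq> insert x \<sigma>" for \<sigma> \<tau> x
  proof (cases "x \<in> \<tau>")
    case True
    then have "\<tau> = insert x (\<tau> - {x})" "\<tau> - {x} \<subseteq> \<sigma>" using that by auto
    then show ?thesis using down[OF that(1)] by blast
  next
    case False
    then show ?thesis using down[OF that(1), of \<tau>] that(2) by blast
  qed
  have "\<tau> \<in> suspend u v K" if "\<sigma> \<in> suspend u v K" "\<tau> \<subseteq> \<sigma>" for \<sigma> \<tau>
    using that(1) down[of \<sigma> \<tau>] cone[of _ \<tau>] that(2) unfolding suspend_def by auto
  moreover have "finite (suspend u v K)" "{} \<in> suspend u v K" "\<And>\<sigma>. \<sigma> \<in> suspend u v K \<Longrightarrow> finite \<sigma>"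
    using assms by (auto simp: suspend_def finite_simplicial_complex_def)
  ultimately show ?thesis
    unfolding finite_simplicial_complex_def by blast
qed

lemma simplicial_iso_suspend:
  assumes "simplicial_iso K L" "K \<noteq> {}" "u \<noteq> v" "u \<notin> \<Union>K" "v \<notin> \<Union>K"
    "u' \<noteq> v'" "u' \<notin> \<Union>L" "v' \<notin> \<Union>L"
  shows "simplicial_iso (suspend u v K) (suspend u' v' L)"
proof -
  obtain f where f: "bij_betw f (\<Union>K) (\<Union>L)" "(`) f ` K = L"
    using assms(1) by (auto simp: simplicial_iso_def)
  define g where "g = f(u := u', v := v')"
  have gf: "g ` \<sigma> = f ` \<sigma>" if "\<sigma> \<in> K" for \<sigma>
    using that assms by (intro image_cong) (auto simp: g_def)
  have guv: "g u = u'" "g v = v'" using assms by (auto simp: g_def)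
  have "bij_betw g (\<Union>K) (\<Union>L)"
    using f(1) assms by (subst bij_betw_cong[of _ _ f]) (auto simp: g_def)
  then have "bij_betw g (insert v (\<Union>K)) (insert v' (\<Union>L))"
    using assms guv notIn_Un_bij_betw[of v "\<Union>K" g "\<Union>L"] by simp
  then have "bij_betw g (insert u (insert v (\<Union>K))) (insert u' (insert v' (\<Union>L)))"
    using assms guv notIn_Un_bij_betw[of u "insert v (\<Union>K)" g "insert v' (\<Union>L)"] by simp
  moreover have "L \<noteq> {}" using f assms by auto
  moreover have "(`) g ` suspend u v K = suspend u' v' L"
    unfolding suspend_def image_Un image_image f(2)[symmetric]
    by (simp add: guv gf cong: image_cong)
  ultimately show ?thesis
    unfolding simplicial_iso_def using assms(2) by (auto simp: Union_suspend)
qed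

text \<open>The pair is no longer free, as \<open>\<sigma>\<close> now also lies in the cones over
  it with apex \<open>u\<close> and \<open>v\<close>. The link of \<open>\<sigma>\<close> in the
  suspension is the suspension of the one vertex of \<open>\<tau> - \<sigma>\<close>, hence a cone
  over that vertex, and the whole open star of \<open>\<sigma>\<close> collapses away.\<close>

lemma elementary_collapse_suspend:
  assumes "elementary_collapse K L" "u \<noteq> v" "u \<notin> \<Union>K" "v \<notin> \<Union>K"
  shows "elementary_collapse\<^sup>*\<^sup>* (suspend u v K) (suspend u v L)"
proof -
  obtain \<sigma> \<tau> where st: "\<sigma> \<in> K" "\<tau> \<in> K" "\<sigma> \<noteq> {}" "\<sigma> \<subset> \<tau>" "card \<tau> = card \<sigma> + 1"
    and L: "L = K - {\<sigma>, \<tau>}" and free: "\<And>\<rho>. \<rho> \<in> K \<Longrightarrow> \<sigma> \<subset> \<rho> \<Longrightarrow> \<rho> = \<tau>"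
    using assms(1) unfolding elementary_collapse_def by blast
  have K: "finite_simplicial_complex K"
    using assms(1) by (simp add: finite_simplicial_complex_elementary_collapse)
  let ?S = "suspend u v K"
  have uv: "u \<notin> \<rho>" "v \<notin> \<rho>" if "\<rho> \<in> K" for \<rho> using that assms by auto
  have link: "{\<rho>. \<rho> \<inter> \<sigma> = {} \<and> \<rho> \<union> \<sigma> \<in> ?S} = suspend u v {{}, \<tau> - \<sigma>}" (is "?A = ?B")
  proof
    have mem: "\<rho> = {} \<or> \<rho> = \<tau> - \<sigma>" if "\<rho> \<inter> \<sigma> = {}" "\<rho> \<union> \<sigma> \<in> K" for \<rho>
    proof (cases "\<rho> \<union> \<sigma> = \<sigma>")
      case False
      then have "\<rho> \<union> \<sigma> = \<tau>" using free[OF that(2)] by blast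
      then show ?thesis using that by blast
    qed (use that in blast)
    have step: "\<rho> \<in> insert x ` {{}, \<tau> - \<sigma>}" if "\<rho> \<inter> \<sigma> = {}" "\<rho> \<union> \<sigma> = insert x \<pi>" "\<pi> \<in> K" "x \<notin> \<Union>K" for \<rho> x \<pi>
    proof -
      have x: "x \<notin> \<sigma>" "x \<notin> \<pi>" using that st by auto
      then have "x \<in> \<rho>" "(\<rho> - {x}) \<union> \<sigma> = \<pi>" using that by auto
      then have "\<rho> - {x} = {} \<or> \<rho> - {x} = \<tau> - \<sigma>" using that by (intro mem) auto
      then show ?thesis using \<open>x \<in> \<rho>\<close> by auto
    qed
    show "?A \<subseteq> ?B"
    proof
      fix \<rho> assume "\<rho> \<in> ?A"
      then have r: "\<rho> \<inter> \<sigma> = {}" "\<rho> \<union> \<sigma> \<in> K \<or> \<rho> \<union> \<sigma> \<in> insert u ` K \<or> \<rho> \<union> \<sigma> \<in> insert v ` K"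
        by (auto simp: suspend_def)
      from r(2) consider "\<rho> \<union> \<sigma> \<in> K" | \<pi> where "\<rho> \<union> \<sigma> = insert u \<pi>" "\<pi> \<in> K"
        | \<pi> where "\<rho> \<union> \<sigma> = insert v \<pi>" "\<pi> \<in> K"
        by blast
      then show "\<rho> \<in> ?B"
      proof cases
        case 1
        then show ?thesis using mem[OF r(1)] by (auto simp: suspend_def)
      next
        case 2
        then show ?thesis using step[OF r(1) 2 assms(3)] by (auto simp: suspend_def)
      next
        case 3
        then show ?thesis using step[OF r(1) 3 assms(4)] by (auto simp: suspend_def)
      qed
    qed
    have "(\<tau> - \<sigma>) \<union> \<sigma> = \<tau>" using st by auto
    then have *: "insert x (\<tau> - \<sigma>) \<union> \<sigma> = insert x \<tau>" for x by auto
    show "?B \<subseteq> ?A"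
      using uv[OF st(1)] uv[OF st(2)] st(1,2) * \<open>(\<tau> - \<sigma>) \<union> \<sigma> = \<tau>\<close>
      by (auto simp: suspend_def)
  qed
  obtain w where w: "\<tau> - \<sigma> = {w}"
  proof -
    have "finite \<sigma>" using K st by (auto simp: finite_simplicial_complex_def)
    then have "card (\<tau> - \<sigma>) = 1" using st by (simp add: card_Diff_subset psubset_imp_subset)
    then show thesis using that card_1_singletonE by blast
  qed
  have wuv: "w \<noteq> u" "w \<noteq> v" using w uv[OF st(2)] by auto
  have "vanishes (suspend u v {{}, \<tau> - \<sigma>})"
    unfolding w using wuv
    by (intro vanishes_cone[of _ w]) (auto simp: suspend_def)
  then have "vanishes {\<rho>. \<rho> \<inter> \<sigma> = {} \<and> \<rho> \<union> \<sigma> \<in> ?S}"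
    by (simp only: link)
  then have "elementary_collapse\<^sup>*\<^sup>* ?S {\<rho>\<in>?S. \<not> \<sigma> \<subseteq> \<rho>}"
    using st K by (intro star_collapse finite_simplicial_complex_suspend)
      (auto simp: finite_simplicial_complex_def)
  moreover have "{\<rho>\<in>?S. \<not> \<sigma> \<subseteq> \<rho>} = suspend u v L"
  proof -
    have KL: "\<sigma> \<subseteq> \<rho> \<longleftrightarrow> \<rho> \<notin> L" if "\<rho> \<in> K" for \<rho>
      using that free[OF that] st unfolding L by blast
    have L': "L = {\<rho>\<in>K. \<not> \<sigma> \<subseteq> \<rho>}" using KL by (auto simp: L)
    have "{\<rho> \<in> insert x ` K. \<not> \<sigma> \<subseteq> \<rho>} = insert x ` L" if "x \<notin> \<sigma>" for x
      using that unfolding L' by (auto simp: subset_insert)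
    then have "{\<rho> \<in> insert u ` K. \<not> \<sigma> \<subseteq> \<rho>} = insert u ` L"
      "{\<rho> \<in> insert v ` K. \<not> \<sigma> \<subseteq> \<rho>} = insert v ` L"
      using uv[OF st(1)] by simp_all
    then show ?thesis
      unfolding suspend_def using L' by (simp add: Collect_disj_eq conj_disj_distribR Un_assoc)
  qed
  ultimately show ?thesis by simp
qed

lemma same_simple_homotopy_type_suspend:
  assumes "same_simple_homotopy_type K L" "u \<noteq> v" "u \<notin> \<Union>K" "v \<notin> \<Union>K"
    "u' \<noteq> v'" "u' \<notin> \<Union>L" "v' \<notin> \<Union>L"
  shows "same_simple_homotopy_type (suspend u v K) (suspend u' v' L)"
proof -
  let ?r = "\<lambda>A B :: nat set set. simplicial_iso A B \<or> elementary_collapse A B"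
  note fin = same_simple_homotopy_type_finite[OF assms(1)]
  obtain K' L' :: "nat set set"
    where iso: "simplicial_iso K K'" "simplicial_iso L L'" and eq: "equivclp ?r K' L'"
    using assms(1) unfolding same_simple_homotopy_type_def by blast
  \<comment> \<open>Shifting the vertices by 2 frees 0 and 1 to be the poles of all intermediate
    complexes at once, so a chain of steps can be suspended step by step.\<close>
  define S :: "nat set set \<Rightarrow> nat set set"
    where "S A = suspend 0 1 ((`) ((`) (\<lambda>x. x + 2)) A)" for A
  have shift: "simplicial_iso A ((`) ((`) (\<lambda>x::nat. x + 2)) A)" for A
    by (rule simplicial_iso_image) (simp add: inj_on_def)
  have fin': "finite_simplicial_complex K'" "finite_simplicial_complex L'"
    using fin iso finite_simplicial_complex_iso by blast+
  have SK: "simplicial_iso (suspend u v K) (S K')"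
    unfolding S_def
    by (rule simplicial_iso_suspend[OF simplicial_iso_trans[OF iso(1) shift]])
      (use assms fin in \<open>auto simp: finite_simplicial_complex_def\<close>)
  have SL: "simplicial_iso (suspend u' v' L) (S L')"
    unfolding S_def
    by (rule simplicial_iso_suspend[OF simplicial_iso_trans[OF iso(2) shift]])
      (use assms fin in \<open>auto simp: finite_simplicial_complex_def\<close>)
  have move: "equivclp ?r (S A) (S B)" if "?r A B" for A B
  proof (cases "simplicial_iso A B")
    case True
    then have 1: "simplicial_iso ((`) ((`) (\<lambda>x. x + 2)) A) ((`) ((`) (\<lambda>x. x + 2)) B)"
      using simplicial_iso_trans[OF simplicial_iso_trans[OF simplicial_iso_sym[OF shift]] shift] by blast
    show ?thesis
    \<comment> \<open>The void complex is not covered by \<open>simplicial_iso_suspend\<close>, but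
      whatever is isomorphic to it is void as well.\<close>
    proof (cases "A = {}")
      case True
      then show ?thesis using \<open>simplicial_iso A B\<close> by (auto simp: simplicial_iso_def)
    next
      case False
      then have "simplicial_iso (S A) (S B)"
        unfolding S_def by (intro simplicial_iso_suspend[OF 1]) auto
      then show ?thesis by (simp add: r_into_equivclp)
    qed
  next
    case False
    then have "elementary_collapse A B" using that by simp
    then have "elementary_collapse ((`) ((`) (\<lambda>x. x + 2)) A) ((`) ((`) (\<lambda>x. x + 2)) B)"
      by (rule elementary_collapse_image) (simp add: inj_on_def)
    then have "elementary_collapse\<^sup>*\<^sup>* (S A) (S B)"
      unfolding S_def by (rule elementary_collapse_suspend) auto
    then have "?r\<^sup>*\<^sup>* (S A) (S B)"
      by (rule rtranclp_mono[THEN predicate2D, rotated]) auto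
    then show ?thesis by (rule rtranclp_into_equivclp)
  qed
  have "equivclp ?r (S K') (S L')"
    using eq
  proof (induction rule: equivclp_induct)
    case (step A B)
    have "equivclp ?r (S A) (S B)"
      using step.hyps(2) move[of A B] equivclp_sym[OF move[of B A]] by (elim disjE) simp_all
    then show ?case by (rule equivclp_trans[OF step.IH])
  qed simp
  then show ?thesis
    by (rule same_simple_homotopy_typeI[OF _ _ SK SL, rotated 2])
      (simp_all add: fin finite_simplicial_complex_suspend)
qed

section \<open>Joins of a finite set of points with copies of the 0-sphere\<close>

text \<open>The initial points are 0, ..., \<open>r\<close>, and each suspension takes the next two
  numbers as its poles.\<close>

primrec points_suspension :: "nat \<Rightarrow> nat \<Rightarrow> nat set set" where
  "points_suspension r 0 = insert {} ((\<lambda>i. {i}) ` {..r})"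
| "points_suspension r (Suc d) =
    suspend (r + 2 * d + 1) (r + 2 * d + 2) (points_suspension r d)"

lemma Union_points_suspension: "\<Union>(points_suspension r d) = {..r + 2 * d}"
proof (induction d)
  case (Suc d)
  have "points_suspension r d \<noteq> {}" by (induction d) (auto simp: suspend_def)
  then show ?case using Suc by (auto simp: Union_suspend)
qed auto

definition wedge_type :: "'a set set \<Rightarrow> nat \<Rightarrow> nat \<Rightarrow> bool" where
  "wedge_type K r d \<longleftrightarrow> same_simple_homotopy_type K (points_suspension r d)"

lemma wedge_type_suspend:
  assumes "wedge_type K r d" "u \<noteq> v" "u \<notin> \<Union>K" "v \<notin> \<Union>K"
  shows "wedge_type (suspend u v K) r (Suc d)"
  using assms unfolding wedge_type_def points_suspension.simps
  by (intro same_simple_homotopy_type_suspend) (auto simp: Union_points_suspension)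

text \<open>An equivalence is stated because both directions occur: deleting an edge uses a collapse
  backwards.\<close>

lemma wedge_type_collapses:
  assumes "elementary_collapse\<^sup>*\<^sup>* K L" "finite_simplicial_complex K"
  shows "wedge_type K r d \<longleftrightarrow> wedge_type L r d"
proof -
  note KL = same_simple_homotopy_type_collapses[OF assms]
  show ?thesis
    unfolding wedge_type_def
    using same_simple_homotopy_type_trans[OF KL]
      same_simple_homotopy_type_trans[OF same_simple_homotopy_type_sym[OF KL]] by blast
qed

lemma wedge_type_iso:
  assumes "simplicial_iso K L" "wedge_type K r d"
  shows "wedge_type L r d"
proof -
  note K = assms(2)[unfolded wedge_type_def]
  have "same_simple_homotopy_type L K"
    by (rule same_simple_homotopy_type_sym)
      (rule same_simple_homotopy_type_iso[OF same_simple_homotopy_type_finite(1)[OF K] assms(1)])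
  then show ?thesis
    unfolding wedge_type_def using K by (rule same_simple_homotopy_type_trans)
qed

text \<open>The edge \<open>uv\<close> is a component of its own, so an independent set is one of
  the remaining graph with at most one of \<open>u\<close> and \<open>v\<close> added.\<close>

lemma ind_split:
  assumes "symp E" "u \<in> V" "v \<in> V" "E u v"
    "\<And>y. y \<in> V \<Longrightarrow> E u y \<Longrightarrow> y = v" "\<And>y. y \<in> V \<Longrightarrow> E v y \<Longrightarrow> y = u" "u \<noteq> v"
  shows "ind V E = suspend u v (ind (V - {u, v}) E)"
proof
  show "ind V E \<subseteq> suspend u v (ind (V - {u, v}) E)"
  proof
    fix S assume S: "S \<in> ind V E"
    then have T: "S - {u, v} \<in> ind (V - {u, v}) E" by (auto simp: ind_def)
    consider "u \<in> S" "v \<notin> S" | "v \<in> S" "u \<notin> S" | "u \<notin> S" "v \<notin> S"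
      using S assms(4) by (auto simp: ind_def)
    then show "S \<in> suspend u v (ind (V - {u, v}) E)"
    proof cases
      case 1
      then have "S = insert u (S - {u, v})" by auto
      then show ?thesis using T unfolding suspend_def by blast
    next
      case 2
      then have "S = insert v (S - {u, v})" by auto
      then show ?thesis using T unfolding suspend_def by blast
    next
      case 3
      then have "S = S - {u, v}" by auto
      then show ?thesis using T unfolding suspend_def by auto
    qed
  qed
next
  \<comment> \<open>A loop at \<open>u\<close> or \<open>v\<close> would make that vertex its own
    neighbour and thus force \<open>u = v\<close>.\<close>
  have no: "\<not> E u u" "\<not> E v v" using assms by blast+
  have "insert u S \<in> ind V E" "insert v S \<in> ind V E" "S \<in> ind V E"
    if "S \<in> ind (V - {u, v}) E" for S
  proof -
    have S: "S \<subseteq> V - {u, v}" "\<And>x y. x \<in> S \<Longrightarrow> y \<in> S \<Longrightarrow> \<not> E x y"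
      using that by (auto simp: ind_def)
    have "\<not> E u y" "\<not> E v y" "\<not> E y u" "\<not> E y v" if "y \<in> S" for y
      using S(1) that assms(5,6)[of y] sympD[OF assms(1)] by blast+
    then show "insert u S \<in> ind V E" "insert v S \<in> ind V E" "S \<in> ind V E"
      using S no assms(2,3) unfolding ind_def by blast+
  qed
  then show "suspend u v (ind (V - {u, v}) E) \<subseteq> ind V E"
    unfolding suspend_def by blast
qed

lemma wedge_type_split:
  assumes "symp E" "u \<in> V" "v \<in> V" "E u v"
    "\<And>y. y \<in> V \<Longrightarrow> E u y \<Longrightarrow> y = v" "\<And>y. y \<in> V \<Longrightarrow> E v y \<Longrightarrow> y = u" "u \<noteq> v"
    "wedge_type (ind (V - {u, v}) E) r d"
  shows "wedge_type (ind V E) r (Suc d)"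
  using wedge_type_suspend[OF assms(8,7)] ind_split[OF assms(1-7)]
  by (auto simp: ind_def)

lemma wedge_type_complete:
  assumes "finite V" "card V = r + 1" "\<And>x y. x \<in> V \<Longrightarrow> y \<in> V \<Longrightarrow> E x y \<longleftrightarrow> x \<noteq> y"
  shows "wedge_type (ind V E) r 0"
proof -
  have "card V = card {..r}" using assms(2) by simp
  then obtain f where f: "bij_betw f V {..r}"
    using assms(1) by (metis finite_atMost finite_same_card_bij)
  have I: "ind V E = insert {} ((\<lambda>x. {x}) ` V)"
  proof -
    have "S = {} \<or> (\<exists>x\<in>V. S = {x})" if "S \<in> ind V E" for S
    proof -
      have "S \<subseteq> V" "\<And>x y. x \<in> S \<Longrightarrow> y \<in> S \<Longrightarrow> x = y"
        using that assms(3) unfolding ind_def by blast+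
      then show ?thesis by blast
    qed
    then show ?thesis using assms(3) by (auto simp: ind_def)
  qed
  then have U: "\<Union>(ind V E) = V" by auto
  have "simplicial_iso (ind V E) ((`) f ` ind V E)"
    by (rule simplicial_iso_image) (use f U in \<open>simp add: bij_betw_def\<close>)
  moreover have "(`) f ` ind V E = points_suspension r 0"
    using f unfolding I by (auto simp: bij_betw_def image_image)
  ultimately show ?thesis
    unfolding wedge_type_def
    using same_simple_homotopy_type_iso[OF finite_simplicial_complex_ind[OF assms(1)]] by simp
qed

section \<open>Certificates for simple homotopy equivalences\<close>

definition linked :: "('a \<times> 'a) list \<Rightarrow> 'a \<Rightarrow> 'a \<Rightarrow> bool" where
  "linked es u v \<longleftrightarrow> (u, v) \<in> set es \<or> (v, u) \<in> set es"

definition nbrs :: "('a \<times> 'a) list \<Rightarrow> 'a \<Rightarrow> 'a list" where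
  "nbrs es u = map snd (filter (\<lambda>e. fst e = u) es) @ map fst (filter (\<lambda>e. snd e = u) es)"

lemma in_set_nbrs [simp]: "v \<in> set (nbrs es u) \<longleftrightarrow> linked es u v"
  by (force simp: nbrs_def linked_def)

lemma symp_linked: "symp (linked es)"
  by (auto simp: symp_def linked_def)

text \<open>A certificate that the graph induced on the vertices outside \<open>ds\<close> dismantles to a graph with an
  isolated vertex \<open>w\<close>: in a pair \<open>(x, y)\<close> the vertex \<open>x\<close> may be deleted because its neighbourhood
  contains that of \<open>y\<close>. Only the vertices in \<open>vs\<close>, whose neighbours are all known, can play the role
  of \<open>y\<close> or \<open>w\<close>.\<close>

fun dismantles :: "('a \<times> 'a) list \<Rightarrow> 'a list \<Rightarrow> 'a list \<Rightarrow> ('a \<times> 'a) list \<Rightarrow> 'a \<Rightarrow> bool" where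
  "dismantles es vs ds [] w \<longleftrightarrow>
    w \<in> set vs \<and> w \<notin> set ds \<and> (\<forall>z\<in>set (nbrs es w). z \<in> set ds)"
| "dismantles es vs ds ((x, y) # fs) w \<longleftrightarrow>
    y \<in> set vs \<and> y \<notin> set ds \<and> x \<noteq> y \<and> \<not> linked es y x \<and>
    (\<forall>z\<in>set (nbrs es y). z \<in> set ds \<or> linked es x z) \<and>
    dismantles es vs (x # ds) fs w"

text \<open>The first three moves insert an edge, delete an edge and delete a vertex; their last two
  arguments certify that the relevant link vanishes. \<open>Split\<close> strips off a component
  that is a single edge.\<close>

datatype 'a move =
    Join 'a 'a "('a \<times> 'a) list" 'a
  | Cut 'a 'a "('a \<times> 'a) list" 'a
  | Drop 'a "('a \<times> 'a) list" 'a
  | Split 'a 'a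

definition link_dismantles where
  "link_dismantles es vs us fs w \<longleftrightarrow>
    dismantles es vs (us @ concat (map (nbrs es) us)) fs w"

definition remove_vertices ::
    "'a list \<Rightarrow> 'a list \<times> ('a \<times> 'a) list \<Rightarrow> 'a list \<times> ('a \<times> 'a) list" where
  "remove_vertices us = (\<lambda>(vs, es).
    (filter (\<lambda>x. x \<notin> set us) vs, filter (\<lambda>(x, y). x \<notin> set us \<and> y \<notin> set us) es))"

text \<open>A \<open>Cut\<close> is a \<open>Join\<close> read backwards, hence its certificate
  refers to the graph without the edge. A \<open>Drop\<close> of a vertex with a loop requires no
  certificate. The ends of a joined or cut edge may lie outside \<open>vs\<close>, which is what
  allows moves at the border of a window.\<close>

fun apply_move :: "'a move \<Rightarrow> 'a list \<times> ('a \<times> 'a) list \<Rightarrow> ('a list \<times> ('a \<times> 'a) list) option" where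
  "apply_move (Join u v fs w) (vs, es) =
    (if u \<noteq> v \<and> link_dismantles es vs [u, v] fs w then Some (vs, (u, v) # es) else None)"
| "apply_move (Cut u v fs w) (vs, es) =
    (let es' = filter (\<lambda>e. e \<noteq> (u, v) \<and> e \<noteq> (v, u)) es in
      if u \<noteq> v \<and> linked es u v \<and> link_dismantles es' vs [u, v] fs w
      then Some (vs, es') else None)"
| "apply_move (Drop x fs w) (vs, es) =
    (if x \<in> set vs \<and> (linked es x x \<or> link_dismantles es vs [x] fs w)
     then Some (remove_vertices [x] (vs, es)) else None)"
| "apply_move (Split u v) (vs, es) =
    (if u \<noteq> v \<and> u \<in> set vs \<and> v \<in> set vs \<and> linked es u v \<and>
       set (nbrs es u) \<subseteq> {v} \<and> set (nbrs es v) \<subseteq> {u}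
     then Some (remove_vertices [u, v] (vs, es)) else None)"

fun is_split :: "'a move \<Rightarrow> bool" where
  "is_split (Split u v) \<longleftrightarrow> True"
| "is_split _ \<longleftrightarrow> False"

fun run :: "'a move list \<Rightarrow> 'a list \<times> ('a \<times> 'a) list \<Rightarrow> ('a list \<times> ('a \<times> 'a) list) option" where
  "run [] g = Some g"
| "run (mv # mvs) g = (case apply_move mv g of None \<Rightarrow> None | Some h \<Rightarrow> run mvs h)"

definition certifies_wedge :: "'a move list \<Rightarrow> 'a list \<Rightarrow> ('a \<times> 'a) list \<Rightarrow> nat \<Rightarrow> nat \<Rightarrow> bool" where
  "certifies_wedge mvs vs es r d \<longleftrightarrow> (case run mvs (vs, es) of None \<Rightarrow> False
    | Some (vs', es') \<Rightarrow> length (filter is_split mvs) = d \<and> length vs' = r + 1 \<and> distinct vs' \<and>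
        (\<forall>x\<in>set vs'. \<forall>y\<in>set vs'. linked es' x y \<longleftrightarrow> x \<noteq> y))"

definition glue :: "('a \<Rightarrow> 'a \<Rightarrow> bool) \<Rightarrow> ('a \<times> 'a) list \<Rightarrow> 'a \<Rightarrow> 'a \<Rightarrow> bool" where
  "glue E es u v \<longleftrightarrow> linked es u v \<or> E u v"

lemma symp_glue: "symp E \<Longrightarrow> symp (glue E es)"
  by (auto simp: symp_def glue_def linked_def)

text \<open>In the following lemmas the list \<open>vs\<close> holds the vertices all of whose edges are listed in
  \<open>es\<close>; the relation \<open>E\<close> is an unknown graph on the other vertices.\<close>

lemma dismantles_vanishes:
  assumes "dismantles es vs ds fs w" "finite H" "symp E"
    "\<And>u v. E u v \<Longrightarrow> u \<notin> set vs \<and> v \<notin> set vs" "H \<inter> set ds = {}" "set vs - set ds \<subseteq> H"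
  shows "vanishes (ind H (glue E es))"
  using assms
proof (induction fs arbitrary: ds H)
  case Nil
  then have "w \<in> H" "\<And>z. linked es w z \<Longrightarrow> z \<notin> H" "\<And>z. \<not> E w z" by auto
  then show ?case
    using Nil.prems(2)
    by (intro vanishes_ind_isolated[of _ w] symp_glue Nil.prems(3)) (auto simp: glue_def[of E es w])
next
  case (Cons f fs)
  obtain x y where f: "f = (x, y)" by (cases f)
  have y: "y \<in> set vs" "y \<notin> set ds" "x \<noteq> y" "\<not> linked es y x"
    "\<And>z. linked es y z \<Longrightarrow> z \<in> set ds \<or> linked es x z"
    and rest: "dismantles es vs (x # ds) fs w"
    using Cons.prems(1) by (auto simp: f)
  show ?case
  proof (rule vanishes_ind_fold[where w = y and x = x])
    show "vanishes (ind (H - {x}) (glue E es))"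
      by (rule Cons.IH[OF rest]) (use Cons.prems in auto)
    show "symp (glue E es)" by (rule symp_glue[OF Cons.prems(3)])
    show "glue E es x z" if "z \<in> H" "glue E es y z" for z
      using that y(1,5) Cons.prems(4,5) by (auto simp: glue_def)
    show "\<not> glue E es y x" using y(1,4) Cons.prems(4) by (auto simp: glue_def)
  qed (use y Cons.prems(2,5,6) in auto)
qed

text \<open>At the border of a window, unlisted neighbours of \<open>us\<close> disappear together
  with the listed ones. They all lie outside \<open>vs\<close>, so every vertex on which the
  certificate relies is still present.\<close>

lemma link_dismantles_vanishes:
  assumes "link_dismantles es vs us fs w" "finite R" "symp E"
    "\<And>u v. E u v \<Longrightarrow> u \<notin> set vs \<and> v \<notin> set vs"
  shows "vanishes (ind {y \<in> R \<union> set vs. \<forall>u\<in>set us. y \<noteq> u \<and> \<not> glue E es u y} (glue E es))"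
  by (rule dismantles_vanishes[OF assms(1)[unfolded link_dismantles_def]])
    (use assms in \<open>auto simp: glue_def\<close>)

section \<open>Soundness of the moves inside an unknown graph\<close>

definition embedded_complex where
  "embedded_complex R E g = ind (R \<union> set (fst g)) (glue E (snd g))"

lemma linked_remove_vertices:
  assumes "u \<notin> set us" "v \<notin> set us"
  shows "linked (snd (remove_vertices us (vs, es))) u v \<longleftrightarrow> linked es u v"
  using assms by (auto simp: linked_def remove_vertices_def)

lemma embedded_complex_remove_vertices:
  assumes "set us \<subseteq> set vs" "R \<inter> set vs = {}"
  shows "embedded_complex R E (remove_vertices us (vs, es)) =
    ind ((R \<union> set vs) - set us) (glue E es)"
  unfolding embedded_complex_def
proof (rule ind_cong)
  show "R \<union> set (fst (remove_vertices us (vs, es))) = R \<union> set vs - set us"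
    using assms by (auto simp: remove_vertices_def)
qed (simp add: glue_def linked_remove_vertices)

text \<open>The type is carried backwards, from the result of the move to its argument, because the
  final graph of a run is the one whose type is known.\<close>

lemma wedge_type_apply_move:
  assumes "apply_move mv g = Some h" "finite R" "R \<inter> set (fst g) = {}" "symp E"
    "\<And>u v. E u v \<Longrightarrow> u \<notin> set (fst g) \<and> v \<notin> set (fst g)"
    "wedge_type (embedded_complex R E h) r d"
  shows "wedge_type (embedded_complex R E g) r (if is_split mv then Suc d else d)"
proof -
  obtain vs es where g: "g = (vs, es)" by (cases g)
  note prems = assms[unfolded g fst_conv]
  let ?V = "R \<union> set vs" and ?G = "glue E es"
  have fin: "finite ?V" using prems by simp
  have V: "embedded_complex R E g = ind ?V ?G" by (simp add: embedded_complex_def g)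
  have "wedge_type (ind ?V ?G) r (if is_split mv then Suc d else d)"
  proof (cases mv)
    case (Join u v fs w)
    then have c: "u \<noteq> v" "link_dismantles es vs [u, v] fs w" and h: "h = (vs, (u, v) # es)"
      using prems(1) by (auto split: if_splits)
    have "elementary_collapse\<^sup>*\<^sup>* (ind ?V ?G)
        (ind ?V (\<lambda>x y. ?G x y \<or> x = u \<and> y = v \<or> x = v \<and> y = u))"
      using link_dismantles_vanishes[OF c(2) prems(2,4,5)] fin prems(4)
      by (intro ind_add_edge c(1) symp_glue) (simp_all add: conj_ac)
    moreover have "(\<lambda>x y. ?G x y \<or> x = u \<and> y = v \<or> x = v \<and> y = u) = glue E ((u, v) # es)"
      by (auto simp: fun_eq_iff glue_def linked_def)
    ultimately have "elementary_collapse\<^sup>*\<^sup>* (ind ?V ?G) (ind ?V (glue E ((u, v) # es)))"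
      by simp
    from wedge_type_collapses[OF this finite_simplicial_complex_ind[OF fin]] show ?thesis
      using prems(6) Join by (simp add: embedded_complex_def h)
  next
    case (Cut u v fs w)
    define es' where "es' = filter (\<lambda>e. e \<noteq> (u, v) \<and> e \<noteq> (v, u)) es"
    from Cut have c: "u \<noteq> v" "link_dismantles es' vs [u, v] fs w" "linked es u v"
      and h: "h = (vs, es')"
      using prems(1) by (auto split: if_splits simp: Let_def es'_def)
    let ?G' = "glue E es'"
    \<comment> \<open>Here the complex of the graph after the move collapses onto that of the graph
      before it.\<close>
    have "elementary_collapse\<^sup>*\<^sup>* (ind ?V ?G')
        (ind ?V (\<lambda>x y. ?G' x y \<or> x = u \<and> y = v \<or> x = v \<and> y = u))"
      using link_dismantles_vanishes[OF c(2) prems(2,4,5)] fin prems(4)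
      by (intro ind_add_edge c(1) symp_glue) (simp_all add: conj_ac)
    moreover have "(\<lambda>x y. ?G' x y \<or> x = u \<and> y = v \<or> x = v \<and> y = u) = ?G"
      using c(3) by (auto simp: fun_eq_iff glue_def linked_def es'_def)
    ultimately have "elementary_collapse\<^sup>*\<^sup>* (ind ?V ?G') (ind ?V ?G)" by simp
    from wedge_type_collapses[OF this finite_simplicial_complex_ind[OF fin]] show ?thesis
      using prems(6) Cut by (simp add: embedded_complex_def h)
  next
    case (Drop x fs w)
    then have c: "x \<in> set vs" "linked es x x \<or> link_dismantles es vs [x] fs w"
      and h: "h = remove_vertices [x] (vs, es)"
      using prems(1) by (auto split: if_splits)
    have H: "embedded_complex R E h = ind (?V - {x}) ?G"
      using embedded_complex_remove_vertices[of "[x]" vs R E es] c prems(3) by (simp add: h)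
    have "elementary_collapse\<^sup>*\<^sup>* (ind ?V ?G) (ind (?V - {x}) ?G)"
    proof (cases "linked es x x")
      case True
      then have "ind ?V ?G = ind (?V - {x}) ?G" by (auto simp: ind_def glue_def)
      then show ?thesis by simp
    next
      case False
      then show ?thesis
        using c(2) link_dismantles_vanishes[OF _ prems(2,4,5), of es "[x]"] fin prems(4)
        by (intro ind_drop_vertex symp_glue) auto
    qed
    from wedge_type_collapses[OF this finite_simplicial_complex_ind[OF fin]] show ?thesis
      using prems(6) Drop by (simp add: H)
  next
    case (Split u v)
    then have c: "u \<noteq> v" "u \<in> set vs" "v \<in> set vs" "linked es u v"
        "set (nbrs es u) \<subseteq> {v}" "set (nbrs es v) \<subseteq> {u}"
      and h: "h = remove_vertices [u, v] (vs, es)"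
      using prems(1) by (simp_all split: if_splits)
    have uv: "z = v" if "linked es u z" for z using that c(5) in_set_nbrs[of z es u] by blast
    have vu: "z = u" if "linked es v z" for z using that c(6) in_set_nbrs[of z es v] by blast
    have H: "embedded_complex R E h = ind (?V - {u, v}) ?G"
      using embedded_complex_remove_vertices[of "[u, v]" vs R E es] c prems(3) by (simp add: h)
    have "wedge_type (ind ?V ?G) r (Suc d)"
    proof (rule wedge_type_split[OF symp_glue[OF prems(4)]])
      show "y = v" if "?G u y" for y using that uv prems(5) c(2) by (auto simp: glue_def)
      show "y = u" if "?G v y" for y using that vu prems(5) c(3) by (auto simp: glue_def)
      show "wedge_type (ind (?V - {u, v}) ?G) r d" using prems(6) by (simp only: H)
    qed (use c(1-4) in \<open>simp_all add: glue_def\<close>)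
    then show ?thesis by (simp add: Split)
  qed
  then show ?thesis by (simp only: V)
qed

lemma apply_move_vertices: "apply_move mv g = Some h \<Longrightarrow> set (fst h) \<subseteq> set (fst g)"
  by (cases mv; cases g) (auto split: if_splits simp: Let_def remove_vertices_def)

lemma wedge_type_run:
  assumes "run mvs g = Some h" "finite R" "R \<inter> set (fst g) = {}" "symp E"
    "\<And>u v. E u v \<Longrightarrow> u \<notin> set (fst g) \<and> v \<notin> set (fst g)"
    "wedge_type (embedded_complex R E h) r d"
  shows "wedge_type (embedded_complex R E g) r (d + length (filter is_split mvs))"
  using assms
proof (induction mvs arbitrary: g)
  case (Cons mv mvs)
  obtain g' where g': "apply_move mv g = Some g'" "run mvs g' = Some h"
    using Cons.prems(1) by (auto split: option.splits)
  note sub = apply_move_vertices[OF g'(1)]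
  have "wedge_type (embedded_complex R E g') r (d + length (filter is_split mvs))"
    by (rule Cons.IH[OF g'(2)]) (use Cons.prems sub in blast)+
  from wedge_type_apply_move[OF g'(1) Cons.prems(2-5) this] show ?case
    by (cases "is_split mv") simp_all
qed simp

lemma certifies_wedge:
  assumes "certifies_wedge mvs vs es r d"
  shows "wedge_type (ind (set vs) (linked es)) r d"
proof -
  obtain vs' es' where run: "run mvs (vs, es) = Some (vs', es')"
    and c: "length (filter is_split mvs) = d" "length vs' = r + 1" "distinct vs'"
      "\<And>x y. x \<in> set vs' \<Longrightarrow> y \<in> set vs' \<Longrightarrow> linked es' x y \<longleftrightarrow> x \<noteq> y"
    using assms by (auto simp: certifies_wedge_def split: option.splits prod.splits)
  have glue: "glue (\<lambda>u v. False) = linked" by (simp add: fun_eq_iff glue_def)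
  have "wedge_type (ind (set vs') (linked es')) r 0"
    using c by (intro wedge_type_complete) (auto simp: distinct_card)
  then have "wedge_type (embedded_complex {} (\<lambda>u v. False) (vs, es)) r (0 + length (filter is_split mvs))"
    by (intro wedge_type_run[OF run]) (auto simp: embedded_complex_def glue symp_def)
  then show ?thesis by (simp add: embedded_complex_def glue c(1))
qed

section \<open>Grids with the first and the last column joined\<close>

definition path_edges :: "nat \<Rightarrow> nat \<Rightarrow> ((nat \<times> nat) \<times> (nat \<times> nat)) list" where
  "path_edges m n =
    [((i, j), (i + 1, j)). j \<leftarrow> [1..<n + 1], i \<leftarrow> [1..<m]] @
    [((i, j), (i, j + 1)). j \<leftarrow> [1..<n], i \<leftarrow> [1..<m + 1]]"

definition turn :: "nat \<Rightarrow> bool \<Rightarrow> nat \<Rightarrow> nat" where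
  "turn m t i = (if t then m + 1 - i else i)"

text \<open>The closing edges are listed regardless of coincidences: with one or two columns some of
  them may be loops or repeat edges of the path. Only \<open>linked\<close> matters, and it is blind
  to multiplicity.\<close>

definition band_edges :: "nat \<Rightarrow> nat \<Rightarrow> bool \<Rightarrow> ((nat \<times> nat) \<times> (nat \<times> nat)) list" where
  "band_edges m n t = path_edges m n @ [((i, n), (turn m t i, 1)). i \<leftarrow> [1..<m + 1]]"

definition cells :: "nat \<Rightarrow> nat \<Rightarrow> (nat \<times> nat) list" where
  "cells m n = [(i, j). j \<leftarrow> [1..<n + 1], i \<leftarrow> [1..<m + 1]]"

lemma simplicial_iso_ind:
  assumes "bij_betw g V W" "\<And>x y. x \<in> V \<Longrightarrow> y \<in> V \<Longrightarrow> E x y \<longleftrightarrow> F (g x) (g y)"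
  shows "simplicial_iso (ind V E) (ind W F)"
proof -
  have inj: "inj_on g V" and W: "W = g ` V" using assms(1) by (auto simp: bij_betw_def)
  have "(`) g ` ind V E = ind W F"
  proof
    show "(`) g ` ind V E \<subseteq> ind W F"
      using assms(2) unfolding ind_def W by blast
    show "ind W F \<subseteq> (`) g ` ind V E"
    proof
      fix S assume S: "S \<in> ind W F"
      then obtain T where T: "T \<subseteq> V" "S = g ` T"
        unfolding ind_def W by (auto elim: subset_imageE)
      have "\<not> E x y" if "x \<in> T" "y \<in> T" for x y
      proof -
        have "\<not> F (g x) (g y)" using S that unfolding ind_def T(2) by auto
        then show ?thesis using assms(2) T(1) that by blast
      qed
      then have "T \<in> ind V E" using T(1) by (auto simp: ind_def)
      then show "S \<in> (`) g ` ind V E" using T(2) by blast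
    qed
  qed
  moreover have "inj_on g (\<Union>(ind V E))"
    by (rule inj_on_subset[OF inj]) (auto simp: ind_def)
  ultimately show ?thesis using simplicial_iso_image[of g "ind V E"] by simp
qed

lemma set_cells: "set (cells m n) = {1..m} \<times> {1..n}"
  by (auto simp: cells_def image_iff simp del: upt_Suc)

lemma linked_append: "linked (es @ fs) u v \<longleftrightarrow> linked es u v \<or> linked fs u v"
  by (auto simp: linked_def)

lemma linked_path_edges:
  "linked (path_edges m n) u v \<longleftrightarrow>
    u \<in> {1..m} \<times> {1..n} \<and> v \<in> {1..m} \<times> {1..n} \<and> grid_adjacent u v"
  by (cases u; cases v) (auto simp: path_edges_def linked_def grid_adjacent_def image_iff simp del: upt_Suc)

lemma linked_band_edges:
  assumes "n \<ge> 1" "u \<in> {1..m} \<times> {1..n}" "v \<in> {1..m} \<times> {1..n}"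
  shows "linked (band_edges m n t) u v \<longleftrightarrow> grid_adjacent u v \<or>
    snd u = n \<and> snd v = 1 \<and> fst v = turn m t (fst u) \<or>
    snd v = n \<and> snd u = 1 \<and> fst u = turn m t (fst v)"
proof -
  have "linked [((i, n), (turn m t i, 1)). i \<leftarrow> [1..<m + 1]] u v \<longleftrightarrow>
    snd u = n \<and> snd v = 1 \<and> fst v = turn m t (fst u) \<or>
    snd v = n \<and> snd u = 1 \<and> fst u = turn m t (fst v)"
    using assms by (cases u; cases v) (auto simp: linked_def image_iff simp del: upt_Suc)
  then show ?thesis
    using assms(2,3) by (simp add: band_edges_def linked_append linked_path_edges)
qed

definition inner_cells :: "nat \<Rightarrow> nat \<Rightarrow> (nat \<times> nat) list" where
  "inner_cells m w = [(i, j). j \<leftarrow> [2..<w + 2], i \<leftarrow> [1..<m + 1]]"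

text \<open>The order, including \<open>rev\<close>, is that of the list which \<open>run\<close>
  returns: each \<open>Join\<close> puts its edge in front, and of the old edges only those inside
  the two border columns survive.\<close>

definition crossed_edges :: "nat \<Rightarrow> nat \<Rightarrow> ((nat \<times> nat) \<times> (nat \<times> nat)) list" where
  "crossed_edges m n = rev [((i, 1), (m + 1 - i, n)). i \<leftarrow> [1..<m + 1]] @
    [((i, j), (i + 1, j)). j \<leftarrow> [1, n], i \<leftarrow> [1..<m]]"

lemma in_set_crossed_edges:
  "((a, b), (c, d)) \<in> set (crossed_edges m n) \<longleftrightarrow>
    b = 1 \<and> d = n \<and> 1 \<le> a \<and> a \<le> m \<and> c = m + 1 - a \<or>
    b = d \<and> (b = 1 \<or> b = n) \<and> 1 \<le> a \<and> a < m \<and> c = a + 1"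
  by (auto simp: crossed_edges_def image_iff simp del: upt_Suc)

lemma linked_crossed_edges:
  assumes "u \<in> {1..m} \<times> {1..}" "v \<in> {1..m} \<times> {1..}" "n \<ge> 3"
  shows "linked (crossed_edges m n) u v \<longleftrightarrow> snd u \<in> {1, n} \<and> snd v \<in> {1, n} \<and>
    (if snd u = snd v then grid_adjacent u v else fst v = m + 1 - fst u)"
proof -
  obtain a b c d where uv: "u = (a, b)" "v = (c, d)" by (cases u; cases v)
  have mc: "c = m + 1 - a \<longleftrightarrow> a = m + 1 - c" using assms(1,2) by (auto simp: uv)
  show ?thesis
    using assms unfolding uv linked_def in_set_crossed_edges mc grid_adjacent_def fst_conv snd_conv
    by (cases "b = d") auto
qed

text \<open>The crossed edges reverse the order of the rows, hence the change of orientability.\<close>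

lemma wedge_type_shorten_band:
  assumes "run mvs (inner_cells m w, path_edges m (w + 2)) = Some ([], crossed_edges m (w + 2))"
    and "n \<ge> 2" "w \<ge> 1"
    and "wedge_type (ind ({1..m} \<times> {1..n}) (linked (band_edges m n (\<not> t)))) r d"
  shows "wedge_type (ind ({1..m} \<times> {1..n + w}) (linked (band_edges m (n + w) t))) r
    (d + length (filter is_split mvs))"
proof -
  let ?C = "{1..m} \<times> {1..n + w}" and ?B = "linked (band_edges m (n + w) t)"
  \<comment> \<open>All columns except the inner ones of the window, which occupies the columns 1 to
    \<open>w + 2\<close>; as \<open>n \<ge> 2\<close>, the column \<open>w + 2\<close> exists and
    belongs to \<open>R\<close>.\<close>
  define R where "R = {1..m} \<times> ({1} \<union> {w + 2..n + w})"
  define E where "E u v \<longleftrightarrow> u \<in> R \<and> v \<in> R \<and> ?B u v" for u v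
  have n1: "1 \<le> n" using assms(2) by simp
  have inner: "set (inner_cells m w) = {1..m} \<times> {2..w + 1}"
    by (auto simp: inner_cells_def image_iff simp del: upt_Suc)
  have C: "R \<union> set (inner_cells m w) = ?C"
    using assms(2,3) by (auto simp: R_def inner)
  have "ind ?C ?B = embedded_complex R E (inner_cells m w, path_edges m (w + 2))"
    unfolding embedded_complex_def fst_conv snd_conv
  proof (rule ind_cong[OF C[symmetric]])
    fix u v assume "u \<in> R \<union> set (inner_cells m w)" "v \<in> R \<union> set (inner_cells m w)"
    then have uv: "u \<in> ?C" "v \<in> ?C" by (simp_all only: C)
    have B: "?B u v \<longleftrightarrow> grid_adjacent u v \<or>
        snd u = n + w \<and> snd v = 1 \<and> fst v = turn m t (fst u) \<or>
        snd v = n + w \<and> snd u = 1 \<and> fst u = turn m t (fst v)"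
      using linked_band_edges[OF _ uv] assms(2) by simp
    show "?B u v = glue E (path_edges m (w + 2)) u v"
      using uv assms(2,3) unfolding glue_def E_def B linked_path_edges
      by (cases u; cases v) (auto simp: R_def grid_adjacent_def)
  qed
  moreover have "wedge_type (embedded_complex R E (inner_cells m w, path_edges m (w + 2))) r
    (d + length (filter is_split mvs))"
  proof (rule wedge_type_run[OF assms(1)])
    show "symp E" using symp_linked unfolding E_def symp_def by metis
    \<comment> \<open>Reversing the rows of all columns but the first straightens the crossed edges
      into edges between the columns 1 and 2. The reversal is passed on to the edges from the last
      column back to the first, which turns \<open>\<not> t\<close> into \<open>t\<close>.\<close>
    define g where "g = (\<lambda>(i, j). if j = 1 then (i, 1) else (m + 1 - i, j + w))"
    define g' where "g' = (\<lambda>(i, j). if j = 1 then (i, 1) else (m + 1 - i, j - w))"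
    have bij: "bij_betw g ({1..m} \<times> {1..n}) R"
      using assms(2) by (intro bij_betw_byWitness[of _ g']) (auto simp: g_def g'_def R_def split: if_splits)
    have "simplicial_iso (ind ({1..m} \<times> {1..n}) (linked (band_edges m n (\<not> t))))
        (ind R (glue E (crossed_edges m (w + 2))))"
    proof (rule simplicial_iso_ind[OF bij])
      fix u v assume uv: "u \<in> {1..m} \<times> {1..n}" "v \<in> {1..m} \<times> {1..n}"
      have R: "g u \<in> R" "g v \<in> R" using uv bij by (auto simp: bij_betw_def)
      then have "g u \<in> ?C" "g v \<in> ?C" using C by blast+
      then have B: "?B (g u) (g v) \<longleftrightarrow> grid_adjacent (g u) (g v) \<or>
        snd (g u) = n + w \<and> snd (g v) = 1 \<and> fst (g v) = turn m t (fst (g u)) \<or>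
        snd (g v) = n + w \<and> snd (g u) = 1 \<and> fst (g u) = turn m t (fst (g v))"
        using linked_band_edges[of "n + w"] assms(2) by simp
      have X: "linked (crossed_edges m (w + 2)) (g u) (g v) \<longleftrightarrow>
        snd (g u) \<in> {1, w + 2} \<and> snd (g v) \<in> {1, w + 2} \<and>
        (if snd (g u) = snd (g v) then grid_adjacent (g u) (g v)
         else fst (g v) = m + 1 - fst (g u))"
        using R assms(3) by (intro linked_crossed_edges) (auto simp: R_def)
      show "linked (band_edges m n (\<not> t)) u v = glue E (crossed_edges m (w + 2)) (g u) (g v)"
      proof -
        obtain a b c d where ab: "u = (a, b)" "v = (c, d)" by (cases u; cases v)
        have bounds: "1 \<le> a" "a \<le> m" "1 \<le> c" "c \<le> m" "1 \<le> b" "b \<le> n" "1 \<le> d" "d \<le> n"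
          using uv by (auto simp: ab)
        show ?thesis
          using bounds assms(2,3) R
          unfolding linked_band_edges[OF n1 uv] glue_def E_def B X
          unfolding grid_adjacent_def ab turn_def
          by (cases "b = 1"; cases "d = 1"; cases t) (auto simp: g_def)
      qed
    qed
    then show "wedge_type (embedded_complex R E ([], crossed_edges m (w + 2))) r d"
      using wedge_type_iso[OF _ assms(4)] by (simp add: embedded_complex_def)
  qed (auto simp: R_def inner E_def)
  ultimately show ?thesis by simp
qed

section \<open>The Moebius grid\<close>

lemma independence_complex_ind: "independence_complex G = ind (verts G) (joined G)"
  by (simp add: independence_complex_def independent_def ind_def)

lemma equiv_generated_equiv: "equiv UNIV (generated_equiv r)"
  unfolding generated_equiv_def
  by (intro equivI) (auto simp: refl_rtrancl trans_rtrancl sym_rtrancl sym_Un_converse)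

lemma generated_equiv_invariant:
  assumes "(x, y) \<in> generated_equiv r" "\<And>u v. (u, v) \<in> r \<Longrightarrow> f u = f v"
  shows "f x = f y"
  using assms(1) unfolding generated_equiv_def
  by (induction rule: rtrancl_induct) (use assms(2) in auto)

text \<open>Every vertex class has exactly one member in the first \<open>n\<close> columns, and an
  edge between classes is seen on any pair of adjacent members.\<close>

lemma simplicial_iso_moebius_grid:
  assumes "n \<ge> 1"
  shows "simplicial_iso (ind ({1..m} \<times> {1..n}) (linked (band_edges m n True)))
    (independence_complex (moebius_grid m n))"
proof -
  define r :: "((nat \<times> nat) \<times> (nat \<times> nat)) set"
    where "r = {((i, 1), (m - i + 1, n + 1)) | i. 1 \<le> i \<and> i \<le> m}"
  define s :: "((nat \<times> nat) set \<times> (nat \<times> nat) set) set"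
    where "s = {({(i, 1), (i + 1, 1)}, {(m - i + 1, n + 1), (m - i, n + 1)}) | i. 1 \<le> i \<and> i < m}"
  define G where "G = moebius_grid m n"
  have G: "G = identify (grid_graph m (n + 1)) r s"
    by (simp add: G_def moebius_grid_def r_def s_def)
  define cls where "cls v = generated_equiv r `` {v}" for v
  \<comment> \<open>The column \<open>n + 1\<close> is folded back onto the column 1 with its rows
    reversed. Because \<open>n \<ge> 1\<close>, these are different columns and \<open>rep\<close>
    fixes the column 1, so \<open>rep\<close> is constant on classes.\<close>
  define rep where "rep = (\<lambda>(i, j). if j = n + 1 then (m + 1 - i, 1) else (i, j))"
  let ?P = "{1..m} \<times> {1..n + 1}" and ?C = "{1..m} \<times> {1..n}"
  have cls_eq: "cls u = cls v \<longleftrightarrow> (u, v) \<in> generated_equiv r" for u v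
    unfolding cls_def by (rule eq_equiv_class_iff[OF equiv_generated_equiv UNIV_I UNIV_I])
  have rep_cls: "rep u = rep v" if "cls u = cls v" for u v
    using that unfolding cls_eq
    by (rule generated_equiv_invariant) (use assms in \<open>auto simp: r_def rep_def\<close>)
  have r_cls: "cls u = cls v" if "(u, v) \<in> r" for u v
    unfolding cls_eq generated_equiv_def using that by auto
  have cls_rep: "cls (rep u) = cls u" if "u \<in> ?P" for u
  proof (cases "snd u = n + 1")
    case True
    then have "(rep u, u) \<in> r"
      using that by (cases u) (auto simp: r_def rep_def)
    then show ?thesis by (rule r_cls)
  next
    case False
    then show ?thesis by (cases u) (simp add: rep_def)
  qed
  have rep_id: "rep u = u" if "u \<in> ?C" for u
    using that by (auto simp: rep_def)
  have rep_C: "rep u \<in> ?C" if "u \<in> ?P" for u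
    using that assms by (auto simp: rep_def)
  have verts: "verts G = cls ` ?C"
  proof -
    have "verts G = cls ` ?P"
      by (auto simp: G identify_def grid_graph_def quotient_def cls_def)
    also have "\<dots> = cls ` ?C"
    proof
      show "cls ` ?P \<subseteq> cls ` ?C"
      proof (rule image_subsetI)
        fix u assume "u \<in> ?P"
        then show "cls u \<in> cls ` ?C" using rep_C cls_rep[symmetric] by (intro image_eqI)
      qed
    qed auto
    finally show ?thesis .
  qed
  have inj: "inj_on cls ?C"
    proof (rule inj_onI)
    fix u v assume "u \<in> ?C" "v \<in> ?C" "cls u = cls v"
    then show "u = v" using rep_cls[of u v] by (simp only: rep_id)
  qed
  \<comment> \<open>Edges related by \<open>s\<close> have the same classes of ends, so the ends of
    an edge class can be read off any member.\<close>
  have ends: "ends G (generated_equiv s `` {e}) = cls ` e" for e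
  proof -
    have inv: "cls ` e = cls ` e'" if "(e, e') \<in> generated_equiv s" for e e'
      using that
    proof (rule generated_equiv_invariant)
      fix d d' assume "(d, d') \<in> s"
      then obtain i where i: "1 \<le> i" "i < m"
        "d = {(i, 1), (i + 1, 1)}" "d' = {(m - i + 1, n + 1), (m - i, n + 1)}"
        by (auto simp: s_def)
      have "((i, 1), (m - i + 1, n + 1)) \<in> r" "((i + 1, 1), (m - (i + 1) + 1, n + 1)) \<in> r"
        using i(1,2) unfolding r_def by auto
      moreover have "m - (i + 1) + 1 = m - i" using i(2) by simp
      ultimately have "cls (i, 1) = cls (m - i + 1, n + 1)" "cls (i + 1, 1) = cls (m - i, n + 1)"
        using r_cls by simp_all
      then show "cls ` d = cls ` d'" by (simp add: i(3,4))
    qed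
    have "(\<Union>e' \<in> generated_equiv s `` {e}. cls ` e') = (\<Union>e' \<in> generated_equiv s `` {e}. cls ` e)"
      by (intro SUP_cong refl) (simp add: inv[of e, symmetric])
    moreover have "(e, e) \<in> generated_equiv s" by (simp add: generated_equiv_def)
    moreover have "ends G (generated_equiv s `` {e}) = (\<Union>e' \<in> generated_equiv s `` {e}. cls ` e')"
      by (auto simp: G identify_def grid_graph_def cls_def)
    ultimately show ?thesis by auto
  qed
  have joined: "joined G (cls u) (cls v) \<longleftrightarrow>
      (\<exists>a\<in>?P. \<exists>b\<in>?P. grid_adjacent a b \<and> rep a = u \<and> rep b = v)" if uv: "u \<in> ?C" "v \<in> ?C" for u v
  proof -
    have edges: "edges G =
        (\<lambda>e. generated_equiv s `` {e}) ` {{a, b} | a b. a \<in> ?P \<and> b \<in> ?P \<and> grid_adjacent a b}"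
      by (simp add: G identify_def grid_graph_def quotient_def UNION_singleton_eq_range)
    have sym: "grid_adjacent b a" if "grid_adjacent a b" for a b
      using that by (auto simp: grid_adjacent_def)
    have rep_iff: "cls a = cls w \<longleftrightarrow> rep a = w" if "a \<in> ?P" "w \<in> ?C" for a w
      using rep_cls[of a w] rep_id[OF that(2)] cls_rep[OF that(1)] by auto
    have "joined G (cls u) (cls v) \<longleftrightarrow>
      (\<exists>a\<in>?P. \<exists>b\<in>?P. grid_adjacent a b \<and> {cls a, cls b} = {cls u, cls v})"
    proof
      assume "joined G (cls u) (cls v)"
      then obtain e where e: "e \<in> edges G" "ends G e = {cls u, cls v}" by (auto simp: joined_def)
      then obtain a b where "e = generated_equiv s `` {{a, b}}" "a \<in> ?P" "b \<in> ?P" "grid_adjacent a b"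
        unfolding edges by blast
      moreover from this have "{cls a, cls b} = {cls u, cls v}" using e(2) by (simp add: ends)
      ultimately show "\<exists>a\<in>?P. \<exists>b\<in>?P. grid_adjacent a b \<and> {cls a, cls b} = {cls u, cls v}"
        by blast
    next
      assume "\<exists>a\<in>?P. \<exists>b\<in>?P. grid_adjacent a b \<and> {cls a, cls b} = {cls u, cls v}"
      then obtain a b where ab: "a \<in> ?P" "b \<in> ?P" "grid_adjacent a b" "{cls a, cls b} = {cls u, cls v}"
        by (elim bexE conjE)
      have "generated_equiv s `` {{a, b}} \<in> edges G"
        unfolding edges
        by (rule imageI, rule CollectI, rule exI[of _ a], rule exI[of _ b])
          (intro conjI refl ab(1-3))
      moreover have "ends G (generated_equiv s `` {{a, b}}) = {cls u, cls v}"
        using ab(4) by (simp add: ends)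
      ultimately show "joined G (cls u) (cls v)" unfolding joined_def by blast
    qed
    also have "\<dots> \<longleftrightarrow> (\<exists>a\<in>?P. \<exists>b\<in>?P. grid_adjacent a b \<and> cls a = cls u \<and> cls b = cls v)"
      unfolding doubleton_eq_iff using sym by blast
    also have "\<dots> \<longleftrightarrow> (\<exists>a\<in>?P. \<exists>b\<in>?P. grid_adjacent a b \<and> rep a = u \<and> rep b = v)"
      using rep_iff uv by (intro bex_cong refl) simp
    finally show ?thesis .
  qed
  have "simplicial_iso (ind ?C (linked (band_edges m n True))) (ind (verts G) (joined G))"
  proof (rule simplicial_iso_ind[of cls])
    show "bij_betw cls ?C (verts G)" using inj verts by (simp add: bij_betw_def)
    fix u v assume uv: "u \<in> ?C" "v \<in> ?C"
    obtain i j i' j' where ij: "u = (i, j)" "v = (i', j')" by (cases u; cases v)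
    have L: "linked (band_edges m n True) u v \<longleftrightarrow> grid_adjacent u v \<or>
        j = n \<and> j' = 1 \<and> i' = m + 1 - i \<or> j' = n \<and> j = 1 \<and> i = m + 1 - i'"
      using linked_band_edges[OF assms uv] by (simp add: ij turn_def)
    show "linked (band_edges m n True) u v \<longleftrightarrow> joined G (cls u) (cls v)"
      unfolding joined[OF uv] L
    proof
      assume "grid_adjacent u v \<or> j = n \<and> j' = 1 \<and> i' = m + 1 - i \<or> j' = n \<and> j = 1 \<and> i = m + 1 - i'"
      then consider "grid_adjacent u v" | "j = n" "j' = 1" "i' = m + 1 - i"
        | "j' = n" "j = 1" "i = m + 1 - i'" by blast
      then show "\<exists>a\<in>?P. \<exists>b\<in>?P. grid_adjacent a b \<and> rep a = u \<and> rep b = v"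
      proof cases
        case 1
        then show ?thesis using uv rep_id by (intro bexI[of _ u] bexI[of _ v]) auto
      next
        case 2
        \<comment> \<open>A closing edge is lifted to the edge between the columns \<open>n\<close>
          and \<open>n + 1\<close> in the row of \<open>u\<close>.\<close>
        then show ?thesis using uv
          by (intro bexI[of _ u] bexI[of _ "(i, n + 1)"])
            (auto simp: ij rep_def grid_adjacent_def)
      next
        case 3
        then show ?thesis using uv
          by (intro bexI[of _ "(i', n + 1)"] bexI[of _ v])
            (auto simp: ij rep_def grid_adjacent_def)
      qed
    next
      assume "\<exists>a\<in>?P. \<exists>b\<in>?P. grid_adjacent a b \<and> rep a = u \<and> rep b = v"
      then obtain a b c d where ab: "(a, b) \<in> ?P" "(c, d) \<in> ?P" "grid_adjacent (a, b) (c, d)"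
        "rep (a, b) = u" "rep (c, d) = v" by auto
      have e: "i = (if b = n + 1 then m + 1 - a else a)" "j = (if b = n + 1 then 1 else b)"
        "i' = (if d = n + 1 then m + 1 - c else c)" "j' = (if d = n + 1 then 1 else d)"
        using ab(4,5) by (auto simp: rep_def ij split: if_splits)
      have bounds: "1 \<le> a" "a \<le> m" "1 \<le> c" "c \<le> m" "1 \<le> b" "b \<le> n + 1" "1 \<le> d" "d \<le> n + 1"
        using ab(1,2) by simp_all
      show "grid_adjacent u v \<or> j = n \<and> j' = 1 \<and> i' = m + 1 - i \<or> j' = n \<and> j = 1 \<and> i = m + 1 - i'"
        using ab(3) bounds assms unfolding grid_adjacent_def ij fst_conv snd_conv e
        by (cases "b = n + 1"; cases "d = n + 1") (simp_all, linarith+)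
    qed
  qed
  then show ?thesis by (simp add: independence_complex_ind G_def)
qed

lemma wedge_type_moebius_grid:
  assumes "wedge_type (ind ({1..m} \<times> {1..n}) (linked (band_edges m n True))) r d" "n \<ge> 1"
  shows "wedge_type (independence_complex (moebius_grid m n)) r d"
  using wedge_type_iso[OF simplicial_iso_moebius_grid[OF assms(2)] assms(1)] .

section \<open>Wedges of cross-polytopal spheres\<close>

text \<open>The dominating vertices lie in \<open>W\<close> and are never deleted, so the vertices
  of \<open>D\<close> may be dropped in any order.\<close>

lemma ind_drop_vertices:
  assumes "finite W" "finite D" "symp E"
    "\<And>x. x \<in> D \<Longrightarrow> \<exists>w\<in>W. w \<noteq> x \<and> \<not> E w x \<and> (\<forall>y\<in>W \<union> D. E w y \<longrightarrow> E x y)"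
    "W \<inter> D = {}"
  shows "elementary_collapse\<^sup>*\<^sup>* (ind (W \<union> D) E) (ind W E)"
  using assms(2,4,5)
proof (induction D)
  case (insert x D)
  obtain w where w: "w \<in> W" "w \<noteq> x" "\<not> E w x" "\<And>y. y \<in> W \<union> insert x D \<Longrightarrow> E w y \<Longrightarrow> E x y"
    using insert.prems(1)[of x] by auto
  have "vanishes (ind {y \<in> W \<union> insert x D. y \<noteq> x \<and> \<not> E x y} E)"
    by (rule vanishes_ind_isolated[of _ w])
      (use assms(1,3) insert.hyps w in \<open>auto dest: sympD\<close>)
  then have "elementary_collapse\<^sup>*\<^sup>* (ind (W \<union> insert x D) E) (ind (W \<union> insert x D - {x}) E)"
    using assms(1,3) insert.hyps by (intro ind_drop_vertex) auto
  also have "W \<union> insert x D - {x} = W \<union> D" using insert.hyps insert.prems(2) by auto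
  finally have "elementary_collapse\<^sup>*\<^sup>* (ind (W \<union> insert x D) E) (ind (W \<union> D) E)" .
  moreover have "elementary_collapse\<^sup>*\<^sup>* (ind (W \<union> D) E) (ind W E)"
  proof (rule insert.IH)
    fix z assume "z \<in> D"
    then show "\<exists>w\<in>W. w \<noteq> z \<and> \<not> E w z \<and> (\<forall>y\<in>W \<union> D. E w y \<longrightarrow> E z y)"
      using insert.prems(1)[of z] by fastforce
  qed (use insert.prems(2) in auto)
  ultimately show ?case by (rule rtranclp_trans)
qed simp

text \<open>The edges can be added in any order. The witness \<open>w\<close> avoids
  \<open>u\<close> and \<open>v\<close> even in the final graph, while its final neighbours are
  already neighbours of \<open>u\<close> or \<open>v\<close> in the initial one; so \<open>w\<close>
  is isolated in the link for every intermediate \<open>F\<close>.\<close>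

lemma ind_add_edges:
  assumes "finite V" "symp F" "symp E'" "\<And>x y. E x y \<Longrightarrow> F x y" "\<And>x y. F x y \<Longrightarrow> E' x y"
    "\<And>u v. u \<in> V \<Longrightarrow> v \<in> V \<Longrightarrow> E' u v \<Longrightarrow> \<not> E u v \<Longrightarrow> u \<noteq> v \<and>
      (\<exists>w\<in>V. w \<noteq> u \<and> w \<noteq> v \<and> \<not> E' u w \<and> \<not> E' v w \<and> (\<forall>z\<in>V. E' w z \<longrightarrow> E u z \<or> E v z))"
  shows "elementary_collapse\<^sup>*\<^sup>* (ind V F) (ind V E')"
  using assms(2,4,5)
proof (induction "card {(x, y) \<in> V \<times> V. E' x y \<and> \<not> F x y}" arbitrary: F rule: less_induct)
  case less
  let ?N = "\<lambda>F. {(x, y) \<in> V \<times> V. E' x y \<and> \<not> F x y}"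
  have fin: "finite (?N F)" for F
    by (rule finite_subset[of _ "V \<times> V"]) (use assms(1) in auto)
  show ?case
  proof (cases "?N F = {}")
    case True
    then have "ind V F = ind V E'" using less.prems(3) by (intro ind_cong) auto
    then show ?thesis by simp
  next
    case False
    then obtain u v where uv: "u \<in> V" "v \<in> V" "E' u v" "\<not> F u v" by auto
    then have "\<not> E u v" using less.prems(2) by blast
    then obtain w where w: "u \<noteq> v" "w \<in> V" "w \<noteq> u" "w \<noteq> v" "\<not> E' u w" "\<not> E' v w"
      "\<And>z. z \<in> V \<Longrightarrow> E' w z \<Longrightarrow> E u z \<or> E v z"
      using assms(6)[OF uv(1-3)] by auto
    let ?F = "\<lambda>x y. F x y \<or> x = u \<and> y = v \<or> x = v \<and> y = u"
    have "vanishes (ind {y \<in> V. y \<noteq> u \<and> y \<noteq> v \<and> \<not> F u y \<and> \<not> F v y} F)"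
    proof (rule vanishes_ind_isolated[of _ w])
      show "w \<in> {y \<in> V. y \<noteq> u \<and> y \<noteq> v \<and> \<not> F u y \<and> \<not> F v y}"
        using w less.prems(3) by auto
      show "\<not> F w z" if "z \<in> {y \<in> V. y \<noteq> u \<and> y \<noteq> v \<and> \<not> F u y \<and> \<not> F v y}" for z
        using that w(7)[of z] less.prems(2,3) by blast
    qed (use assms(1) less.prems(1) in auto)
    then have "elementary_collapse\<^sup>*\<^sup>* (ind V F) (ind V ?F)"
      by (rule ind_add_edge[OF assms(1) less.prems(1) w(1)])
    moreover have "elementary_collapse\<^sup>*\<^sup>* (ind V ?F) (ind V E')"
    proof (rule less.hyps)
      have "?N ?F \<subset> ?N F" using uv by auto
      then show "card (?N ?F) < card (?N F)" by (rule psubset_card_mono[OF fin])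
      show "symp ?F" using less.prems(1) by (auto simp: symp_def)
      show "?F x y \<Longrightarrow> E' x y" for x y
        using less.prems(3) uv(3) assms(3) by (auto dest: sympD)
    qed (use less.prems(2) in blast)
    ultimately show ?thesis by (rule rtranclp_trans)
  qed
qed

section \<open>Spheres and their wedges as independence complexes\<close>

definition opposite :: "nat \<times> nat \<Rightarrow> nat \<times> nat \<Rightarrow> bool" where
  "opposite u v \<longleftrightarrow> fst u = fst v \<and> snd u \<noteq> snd v"

text \<open>A proper subset of a pair has at most one element, so the join is the independence
  complex of \<open>n + 1\<close> disjoint edges.\<close>

lemma diamond_ind: "diamond n = ind ({..n} \<times> {..1}) opposite"
proof
  show "diamond n \<subseteq> ind ({..n} \<times> {..1}) opposite"
  proof
    fix \<sigma> assume "\<sigma> \<in> diamond n"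
    then obtain f where f: "\<sigma> = Sigma {..<n + 1} f" "\<And>j. j < n + 1 \<Longrightarrow> f j \<subset> {0..1}"
      unfolding diamond_def join_copies_def simplex_boundary_def by blast
    have "\<not> (x \<in> f j \<and> y \<in> f j \<and> x \<noteq> y)" if "j < n + 1" for j x y
    proof
      assume a: "x \<in> f j \<and> y \<in> f j \<and> x \<noteq> y"
      then have "x \<le> 1" "y \<le> 1" using f(2)[OF that] by auto
      then have "{0..1} = {x, y}" using a by auto
      then show False using f(2)[OF that] a by auto
    qed
    moreover have "x \<le> 1" if "j < n + 1" "x \<in> f j" for j x using f(2)[OF that(1)] that(2) by auto
    ultimately show "\<sigma> \<in> ind ({..n} \<times> {..1}) opposite"
      unfolding ind_def f(1) opposite_def by (auto simp: less_Suc_eq_le)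
  qed
  show "ind ({..n} \<times> {..1}) opposite \<subseteq> diamond n"
  proof
    fix \<sigma> assume s: "\<sigma> \<in> ind ({..n} \<times> {..1}) opposite"
    define f where "f j = {e. (j, e) \<in> \<sigma>}" for j
    have sub: "\<sigma> \<subseteq> {..n} \<times> {..1}" using s by (simp add: ind_def)
    have no: "\<not> ((j, 0) \<in> \<sigma> \<and> (j, 1) \<in> \<sigma>)" for j
    proof
      assume "(j, 0) \<in> \<sigma> \<and> (j, 1) \<in> \<sigma>"
      then have "\<not> opposite (j, 0) (j, 1)" using s unfolding ind_def by blast
      then show False by (simp add: opposite_def)
    qed
    have "f j \<subset> {0..1}" for j
    proof
      show "f j \<subseteq> {0..1}" using sub by (auto simp: f_def)
      show "f j \<noteq> {0..1}" using no[of j] by (auto simp: f_def)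
    qed
    moreover have "\<sigma> = Sigma {..<n + 1} f" using sub by (auto simp: f_def)
    ultimately show "\<sigma> \<in> diamond n"
      unfolding diamond_def join_copies_def simplex_boundary_def by blast
  qed
qed

lemma wedge_type_diamond: "wedge_type (diamond n) 1 n"
  unfolding diamond_ind
proof (induction n)
  case 0
  show ?case by (rule wedge_type_complete) (auto simp: opposite_def)
next
  case (Suc n)
  have e: "{..Suc n} \<times> {..1} - {(Suc n, 0), (Suc n, 1)} = {..n} \<times> {..1::nat}"
    by (auto simp: le_Suc_eq)
  show ?case
  proof (rule wedge_type_split[of _ "(Suc n, 0)" _ "(Suc n, 1)"])
    show "wedge_type (ind ({..Suc n} \<times> {..1} - {(Suc n, 0), (Suc n, 1)}) opposite) 1 n"
      using Suc by (simp only: e)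
  qed (auto simp: opposite_def symp_def)
qed

definition wedge_vertices :: "nat \<Rightarrow> (nat \<Rightarrow> 'a) \<Rightarrow> 'a set \<Rightarrow> (nat \<times> 'a) option set" where
  "wedge_vertices r b V = insert None (Some ` {(j, v). j < r \<and> v \<in> V \<and> v \<noteq> b j})"

text \<open>\<open>None\<close> plays the role of \<open>b j\<close> towards each copy
  \<open>j\<close>, and joining all other vertices of different copies forbids simplices that meet
  two copies.\<close>

fun wedge_adjacent ::
    "(nat \<Rightarrow> 'a) \<Rightarrow> ('a \<Rightarrow> 'a \<Rightarrow> bool) \<Rightarrow> (nat \<times> 'a) option \<Rightarrow> (nat \<times> 'a) option \<Rightarrow> bool" where
  "wedge_adjacent b E None None \<longleftrightarrow> False"
| "wedge_adjacent b E None (Some (j, v)) \<longleftrightarrow> E (b j) v"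
| "wedge_adjacent b E (Some (j, v)) None \<longleftrightarrow> E v (b j)"
| "wedge_adjacent b E (Some (j, u)) (Some (k, v)) \<longleftrightarrow> j \<noteq> k \<or> E u v"

text \<open>Apart from \<open>None\<close>, an independent set meets at most one copy; if it meets
  none, \<open>r \<ge> 1\<close> supplies one that contains it.\<close>

lemma wedge_copies_ind:
  assumes "r \<ge> 1" "\<And>j. j < r \<Longrightarrow> b j \<in> V" "\<And>x. \<not> E x x"
  shows "wedge_copies r b (ind V E) = ind (wedge_vertices r b V) (wedge_adjacent b E)"
proof
  show "wedge_copies r b (ind V E) \<subseteq> ind (wedge_vertices r b V) (wedge_adjacent b E)"
    unfolding wedge_copies_def ind_def wedge_vertices_def by (auto split: if_splits)
  show "ind (wedge_vertices r b V) (wedge_adjacent b E) \<subseteq> wedge_copies r b (ind V E)"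
  proof
    fix S assume S: "S \<in> ind (wedge_vertices r b V) (wedge_adjacent b E)"
    have adj: "\<not> wedge_adjacent b E x y" if "x \<in> S" "y \<in> S" for x y
      using S that by (auto simp: ind_def)
    have vert: "j < r \<and> v \<in> V \<and> v \<noteq> b j" if "Some (j, v) \<in> S" for j v
      using S that by (auto simp: ind_def wedge_vertices_def)
    obtain j where j: "j < r" "\<And>k v. Some (k, v) \<in> S \<Longrightarrow> k = j"
    proof (cases "S \<subseteq> {None}")
      case True
      then show thesis using that[of 0] assms(1) by auto
    next
      case False
      then obtain x where "x \<in> S" "x \<notin> {None}" by blast
      then obtain p where "Some p \<in> S" by (cases x) auto
      then obtain k v where kv: "Some (k, v) \<in> S" by (cases p) simp
      have "k' = k" if "Some (k', v') \<in> S" for k' v' using adj[OF kv that] by auto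
      then show thesis using that[of k] vert[OF kv] by blast
    qed
    define \<sigma> where "\<sigma> = {v. Some (j, v) \<in> S} \<union> (if None \<in> S then {b j} else {})"
    let ?\<eta> = "\<lambda>v. if v = b j then None else Some (j, v)"
    have "x \<in> ?\<eta> ` \<sigma>" if "x \<in> S" for x
    proof (cases x)
      case None
      then show ?thesis using that by (auto simp: \<sigma>_def)
    next
      case (Some p)
      obtain k v where "p = (k, v)" by (cases p)
      then have "x = Some (j, v)" "v \<noteq> b j" using that Some j(2) vert by auto
      then show ?thesis using that by (auto simp: \<sigma>_def)
    qed
    moreover have "?\<eta> v \<in> S" if "v \<in> \<sigma>" for v
      using that vert by (auto simp: \<sigma>_def split: if_splits)
    ultimately have "S = ?\<eta> ` \<sigma>" by blast
    moreover have "\<sigma> \<in> ind V E"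
    proof -
      have "\<not> E x y" if "x \<in> \<sigma>" "y \<in> \<sigma>" for x y
        using that adj[of None "Some (j, y)"] adj[of "Some (j, x)" None]
          adj[of "Some (j, x)" "Some (j, y)"] assms(3)
        by (auto simp: \<sigma>_def split: if_splits)
      moreover have "\<sigma> \<subseteq> V" using vert assms(2) j(1) by (auto simp: \<sigma>_def)
      ultimately show ?thesis by (auto simp: ind_def)
    qed
    ultimately show "S \<in> wedge_copies r b (ind V E)"
      unfolding wedge_copies_def using j(1) by blast
  qed
qed

text \<open>Automorphisms of the single copies move the base vertices, which reduces arbitrary ones
  to a standard choice.\<close>

lemma simplicial_iso_wedge:
  assumes "\<And>j. bij_betw (f j) V V" "\<And>j. j < r \<Longrightarrow> b j \<in> V"
    "\<And>j u v. u \<in> V \<Longrightarrow> v \<in> V \<Longrightarrow> E u v \<longleftrightarrow> E (f j u) (f j v)"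
  shows "simplicial_iso (ind (wedge_vertices r b V) (wedge_adjacent b E))
    (ind (wedge_vertices r (\<lambda>j. f j (b j)) V) (wedge_adjacent (\<lambda>j. f j (b j)) E))"
proof (rule simplicial_iso_ind)
  let ?b = "\<lambda>j. f j (b j)"
  define g where "g = map_option (\<lambda>(j, v). (j, f j v))"
  have inj: "f j u = f j v \<longleftrightarrow> u = v" if "u \<in> V" "v \<in> V" for j u v
    using assms(1)[of j] that by (auto simp: bij_betw_def inj_on_def)
  have fV: "f j u \<in> V" if "u \<in> V" for j u
    using assms(1)[of j] that by (auto simp: bij_betw_def)
  show "bij_betw g (wedge_vertices r b V) (wedge_vertices r ?b V)"
    unfolding bij_betw_def
  proof
    show "inj_on g (wedge_vertices r b V)"
      using inj by (auto simp: inj_on_def g_def wedge_vertices_def)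
    show "g ` wedge_vertices r b V = wedge_vertices r ?b V"
    proof
      show "g ` wedge_vertices r b V \<subseteq> wedge_vertices r ?b V"
        using inj fV assms(2) by (auto simp: g_def wedge_vertices_def)
      show "wedge_vertices r ?b V \<subseteq> g ` wedge_vertices r b V"
      proof
        fix x assume x: "x \<in> wedge_vertices r ?b V"
        show "x \<in> g ` wedge_vertices r b V"
        proof (cases x)
          case None
          then show ?thesis by (auto simp: g_def wedge_vertices_def image_iff intro: bexI[of _ None])
        next
          case (Some p)
          obtain j v where p: "p = (j, v)" by (cases p)
          have jv: "j < r" "v \<in> V" "v \<noteq> ?b j" using x by (auto simp: Some p wedge_vertices_def)
          have "v \<in> f j ` V" using jv(2) assms(1)[of j] by (simp add: bij_betw_def)
          then obtain u where u: "u \<in> V" "f j u = v" by blast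
          then have "g (Some (j, u)) = x" by (simp add: g_def Some p)
          moreover have "Some (j, u) \<in> wedge_vertices r b V"
            using u jv by (auto simp: wedge_vertices_def)
          ultimately show ?thesis by blast
        qed
      qed
    qed
  qed
  fix x y assume "x \<in> wedge_vertices r b V" "y \<in> wedge_vertices r b V"
  then show "wedge_adjacent b E x y = wedge_adjacent ?b E (g x) (g y)"
    using assms(2,3) by (auto simp: wedge_vertices_def g_def)
qed


text \<open>The wedge of \<open>r\<close> spheres arises from the join of \<open>r + 1\<close> points, namely \<open>None\<close> and the
  antipodes \<open>Some (j, 0, 1)\<close>, with \<open>d\<close> pairs of points by two kinds of simple equivalences. First
  each of the points \<open>Some (0, i, e)\<close> with \<open>i > 0\<close> receives twins \<open>Some (j, i, e)\<close>. Then edges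
  between different copies are added, those at the antipodes with the twin in the same copy as a
  witness, and after that all others with \<open>None\<close> as a witness.\<close>

fun twin_edge :: "(nat \<times> nat \<times> nat) option \<Rightarrow> (nat \<times> nat \<times> nat) option \<Rightarrow> bool" where
  "twin_edge None None \<longleftrightarrow> False"
| "twin_edge None (Some (k, c, d)) \<longleftrightarrow> c = 0"
| "twin_edge (Some (j, a, b)) None \<longleftrightarrow> a = 0"
| "twin_edge (Some (j, a, b)) (Some (k, c, d)) \<longleftrightarrow>
    j \<noteq> k \<and> a = 0 \<and> c = 0 \<or> a = c \<and> a > 0 \<and> b \<noteq> d"

fun half_wedge_edge :: "(nat \<times> nat \<times> nat) option \<Rightarrow> (nat \<times> nat \<times> nat) option \<Rightarrow> bool" where
  "half_wedge_edge None None \<longleftrightarrow> False"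
| "half_wedge_edge None (Some (k, c, d)) \<longleftrightarrow> c = 0"
| "half_wedge_edge (Some (j, a, b)) None \<longleftrightarrow> a = 0"
| "half_wedge_edge (Some (j, a, b)) (Some (k, c, d)) \<longleftrightarrow>
    j \<noteq> k \<and> (a = 0 \<or> c = 0) \<or> a = c \<and> a > 0 \<and> b \<noteq> d"

fun full_wedge_edge :: "(nat \<times> nat \<times> nat) option \<Rightarrow> (nat \<times> nat \<times> nat) option \<Rightarrow> bool" where
  "full_wedge_edge None None \<longleftrightarrow> False"
| "full_wedge_edge None (Some (k, c, d)) \<longleftrightarrow> c = 0"
| "full_wedge_edge (Some (j, a, b)) None \<longleftrightarrow> a = 0"
| "full_wedge_edge (Some (j, a, b)) (Some (k, c, d)) \<longleftrightarrow> j \<noteq> k \<or> a = c \<and> a > 0 \<and> b \<noteq> d"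

lemma symp_wedge_edges: "symp twin_edge" "symp half_wedge_edge" "symp full_wedge_edge"
proof -
  have "twin_edge x y \<Longrightarrow> twin_edge y x" for x y
    by (induction x y rule: twin_edge.induct) auto
  then show "symp twin_edge" by (rule sympI)
  have "half_wedge_edge x y \<Longrightarrow> half_wedge_edge y x" for x y
    by (induction x y rule: half_wedge_edge.induct) auto
  then show "symp half_wedge_edge" by (rule sympI)
  have "full_wedge_edge x y \<Longrightarrow> full_wedge_edge y x" for x y
    by (induction x y rule: full_wedge_edge.induct) auto
  then show "symp full_wedge_edge" by (rule sympI)
qed

text \<open>The base vertex of each copy is \<open>(0, 0)\<close>, represented by
  \<open>None\<close>; hence only the last coordinate 1 occurs at level 0.\<close>

definition core :: "nat \<Rightarrow> nat \<Rightarrow> (nat \<times> nat \<times> nat) option set" where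
  "core r d = insert None (Some ` ({..<r} \<times> {0} \<times> {1} \<union> {0} \<times> {1..d} \<times> {..1}))"

definition twins :: "nat \<Rightarrow> nat \<Rightarrow> (nat \<times> nat \<times> nat) option set" where
  "twins r d = Some ` ({1..<r} \<times> {1..d} \<times> {..1})"

lemma core_Un_twins:
  "r \<ge> 1 \<Longrightarrow> core r d \<union> twins r d = wedge_vertices r (\<lambda>_. (0, 0)) ({..d} \<times> {..1})"
  unfolding core_def twins_def wedge_vertices_def
  by (auto simp: image_iff)

lemma wedge_type_core:
  assumes "r \<ge> 1"
  shows "wedge_type (ind (core r d) twin_edge) r d"
proof (induction d)
  case 0
  have core: "core r 0 = insert None ((\<lambda>j. Some (j, 0, 1)) ` {..<r})"
    by (auto simp: core_def)
  show ?case
  proof (rule wedge_type_complete)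
    have "card ((\<lambda>j. Some (j, 0::nat, 1::nat)) ` {..<r}) = r"
      by (subst card_image) (auto simp: inj_on_def)
    then show "card (core r 0) = r + 1" unfolding core by (subst card_insert_disjoint) auto
  qed (auto simp: core)
next
  case (Suc d)
  have e: "core r (Suc d) - {Some (0, Suc d, 0), Some (0, Suc d, 1)} = core r d"
    by (auto simp: core_def le_Suc_eq)
  show ?case
  proof (rule wedge_type_split[OF symp_wedge_edges(1), of "Some (0, Suc d, 0)" _ "Some (0, Suc d, 1)"])
    show "wedge_type (ind (core r (Suc d) - {Some (0, Suc d, 0), Some (0, Suc d, 1)}) twin_edge) r d"
      using Suc by (simp only: e)
  qed (auto simp: core_def)
qed

lemma mem_core [simp]:
  "None \<in> core r d"
  "Some (j, i, e) \<in> core r d \<longleftrightarrow>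
    j < r \<and> i = 0 \<and> e = 1 \<or> j = 0 \<and> 1 \<le> i \<and> i \<le> d \<and> e \<le> 1"
  by (auto simp: core_def)

lemma mem_twins [simp]:
  "None \<notin> twins r d"
  "Some (j, i, e) \<in> twins r d \<longleftrightarrow> 1 \<le> j \<and> j < r \<and> 1 \<le> i \<and> i \<le> d \<and> e \<le> 1"
  by (auto simp: twins_def)

lemma finite_core_twins: "finite (core r d)" "finite (twins r d)"
  by (simp_all add: core_def twins_def)

lemma option_triple_cases:
  fixes x :: "(nat \<times> nat \<times> nat) option"
  obtains "x = None" | j i e where "x = Some (j, i, e)"
  by (cases x) auto

lemma collapse_twins:
  assumes "r \<ge> 1"
  shows "elementary_collapse\<^sup>*\<^sup>* (ind (core r d \<union> twins r d) twin_edge) (ind (core r d) twin_edge)"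
proof (rule ind_drop_vertices[OF finite_core_twins symp_wedge_edges(1)])
  fix x assume x: "x \<in> twins r d"
  then obtain j i e where ji: "x = Some (j, i, e)" by (cases x rule: option_triple_cases) auto
  have b: "1 \<le> j" "j < r" "1 \<le> i" "i \<le> d" "e \<le> 1" using x by (simp_all add: ji)
  \<comment> \<open>Above level 0 the relation \<open>twin_edge\<close> ignores the copy, so the
    original in copy 0 dominates its twin.\<close>
  have "twin_edge x y" if "twin_edge (Some (0, i, e)) y" for y
    using that b by (cases y rule: option_triple_cases) (auto simp: ji)
  then show "\<exists>w\<in>core r d. w \<noteq> x \<and> \<not> twin_edge w x \<and>
      (\<forall>y\<in>core r d \<union> twins r d. twin_edge w y \<longrightarrow> twin_edge x y)"
    using b by (intro bexI[of _ "Some (0, i, e)"]) (auto simp: ji)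
qed (auto simp: core_def twins_def)

lemma mem_core_twins:
  assumes "r \<ge> 1"
  shows "Some (j, i, e) \<in> core r d \<union> twins r d \<longleftrightarrow>
    j < r \<and> (i = 0 \<and> e = 1 \<or> 1 \<le> i \<and> i \<le> d \<and> e \<le> 1)"
  using assms by (cases "j = 0") auto

lemma collapse_half_wedge:
  assumes "r \<ge> 1"
  shows "elementary_collapse\<^sup>*\<^sup>* (ind (core r d \<union> twins r d) twin_edge)
    (ind (core r d \<union> twins r d) half_wedge_edge)"
proof (rule ind_add_edges[OF _ symp_wedge_edges(1,2)])
  let ?V = "core r d \<union> twins r d"
  show "finite ?V" by (simp add: finite_core_twins)
  show "half_wedge_edge x y" if "twin_edge x y" for x y
    using that by (cases x rule: option_triple_cases; cases y rule: option_triple_cases) auto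
  fix u v assume uv: "u \<in> ?V" "v \<in> ?V" "half_wedge_edge u v" "\<not> twin_edge u v"
  then obtain j a b k c d' where e: "u = Some (j, a, b)" "v = Some (k, c, d')"
    by (cases u rule: option_triple_cases; cases v rule: option_triple_cases) auto
  have jk: "j \<noteq> k" "a = 0 \<and> c > 0 \<or> c = 0 \<and> a > 0"
    using uv(3,4) by (auto simp: e)
  \<comment> \<open>One of \<open>u\<close>, \<open>v\<close> is an antipode; \<open>w\<close> is
    the twin of the other in the copy of that antipode. Neighbours of \<open>w\<close> are antipodes
    of other copies, hence already adjacent to the antipode, or opposite points at its own level,
    adjacent to the other end.\<close>
  define w where "w = (if a = 0 then Some (j, c, d') else Some (k, a, b))"
  have "w \<in> ?V"
    using jk uv(1,2) unfolding w_def e mem_core_twins[OF assms] by (auto simp: mem_core_twins[OF assms] simp del: Un_iff)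
  moreover have "twin_edge u z \<or> twin_edge v z" if "half_wedge_edge w z" "z \<in> ?V" for z
    using that jk uv(1,2) unfolding w_def e mem_core_twins[OF assms]
    by (cases z rule: option_triple_cases) (auto simp: mem_core_twins[OF assms] split: if_splits simp del: Un_iff)
  moreover have "w \<noteq> u" "w \<noteq> v" "\<not> half_wedge_edge u w" "\<not> half_wedge_edge v w" "u \<noteq> v"
    using jk by (auto simp: w_def e)
  ultimately show "u \<noteq> v \<and> (\<exists>w\<in>?V. w \<noteq> u \<and> w \<noteq> v \<and> \<not> half_wedge_edge u w \<and>
      \<not> half_wedge_edge v w \<and> (\<forall>z\<in>?V. half_wedge_edge w z \<longrightarrow> twin_edge u z \<or> twin_edge v z))"
    by blast
qed auto

lemma collapse_full_wedge:
  assumes "r \<ge> 1"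
  shows "elementary_collapse\<^sup>*\<^sup>* (ind (core r d \<union> twins r d) half_wedge_edge)
    (ind (core r d \<union> twins r d) full_wedge_edge)"
proof (rule ind_add_edges[OF _ symp_wedge_edges(2,3)])
  let ?V = "core r d \<union> twins r d"
  show "finite ?V" by (simp add: finite_core_twins)
  show "full_wedge_edge x y" if "half_wedge_edge x y" for x y
    using that by (cases x rule: option_triple_cases; cases y rule: option_triple_cases) auto
  fix u v assume uv: "u \<in> ?V" "v \<in> ?V" "full_wedge_edge u v" "\<not> half_wedge_edge u v"
  then obtain j a b k c d' where e: "u = Some (j, a, b)" "v = Some (k, c, d')"
    by (cases u rule: option_triple_cases; cases v rule: option_triple_cases) auto
  have jk: "j \<noteq> k" "a > 0" "c > 0"
    using uv(3,4) by (auto simp: e)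
  \<comment> \<open>The neighbours of \<open>None\<close> are the antipodes, and as
    \<open>j \<noteq> k\<close> each of them lies in a copy other than that of \<open>u\<close> or
    other than that of \<open>v\<close>.\<close>
  have "half_wedge_edge u z \<or> half_wedge_edge v z" if "full_wedge_edge None z" for z
    using that jk unfolding e by (cases z rule: option_triple_cases) auto
  moreover have "None \<noteq> u" "None \<noteq> v" "\<not> full_wedge_edge u None" "\<not> full_wedge_edge v None" "u \<noteq> v"
    using jk by (auto simp: e)
  ultimately show "u \<noteq> v \<and> (\<exists>w\<in>?V. w \<noteq> u \<and> w \<noteq> v \<and> \<not> full_wedge_edge u w \<and>
      \<not> full_wedge_edge v w \<and> (\<forall>z\<in>?V. full_wedge_edge w z \<longrightarrow> half_wedge_edge u z \<or> half_wedge_edge v z))"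
    by (intro conjI bexI[of _ None]) auto
qed auto

section \<open>Independence of the choice of base vertices\<close>

definition swap_zero :: "nat \<Rightarrow> nat \<Rightarrow> nat" where
  "swap_zero a x = (if x = a then 0 else if x = 0 then a else x)"

lemma swap_zero_inverse [simp]: "swap_zero a (swap_zero a x) = x"
  by (auto simp: swap_zero_def)

lemma wedge_type_wedge_copies:
  assumes "r \<ge> 1" "\<And>j. j < r \<Longrightarrow> b j \<in> \<Union>(diamond d)"
  shows "wedge_type (wedge_copies r b (diamond d)) r d"
proof -
  let ?V = "{..d} \<times> {..1::nat}"
  let ?U = "core r d \<union> twins r d"
  have U: "finite ?U" by (simp add: finite_core_twins)
  have irrefl: "\<not> opposite x x" for x by (simp add: opposite_def)
  have bV: "b j \<in> ?V" if "j < r" for j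
    using assms(2)[OF that] by (auto simp: diamond_ind ind_def)
  have "wedge_type (ind ?U twin_edge) r d"
    using wedge_type_collapses[OF collapse_twins[OF assms(1)]] wedge_type_core[OF assms(1)]
      finite_simplicial_complex_ind[OF U] by blast
  then have "wedge_type (ind ?U half_wedge_edge) r d"
    using wedge_type_collapses[OF collapse_half_wedge[OF assms(1)]] finite_simplicial_complex_ind[OF U]
    by blast
  then have full: "wedge_type (ind ?U full_wedge_edge) r d"
    using wedge_type_collapses[OF collapse_full_wedge[OF assms(1)]] finite_simplicial_complex_ind[OF U]
    by blast
  have "ind ?U full_wedge_edge =
      ind (wedge_vertices r (\<lambda>_. (0, 0)) ?V) (wedge_adjacent (\<lambda>_. (0, 0)) opposite)"
  proof (rule ind_cong[OF core_Un_twins[OF assms(1)]])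
    fix u v assume "u \<in> wedge_vertices r (\<lambda>_. (0, 0)) ?V" "v \<in> wedge_vertices r (\<lambda>_. (0, 0)) ?V"
    then show "full_wedge_edge u v = wedge_adjacent (\<lambda>_. (0, 0)) opposite u v"
      by (cases u rule: option_triple_cases; cases v rule: option_triple_cases)
        (auto simp: wedge_vertices_def opposite_def)
  qed
  then have std: "wedge_type (ind (wedge_vertices r (\<lambda>_. (0, 0)) ?V)
      (wedge_adjacent (\<lambda>_. (0, 0)) opposite)) r d"
    using full by simp
  \<comment> \<open>Transposing 0 with the coordinates of \<open>b j\<close> is an automorphism of
    the sphere that sends \<open>b j\<close> to \<open>(0, 0)\<close>. Beyond \<open>r\<close>
    nothing is known about \<open>b j\<close>, hence \<open>id\<close>.\<close>
  define f where "f j = (if j < r then map_prod (swap_zero (fst (b j))) (swap_zero (snd (b j))) else id)" for j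
  have iso: "simplicial_iso (ind (wedge_vertices r b ?V) (wedge_adjacent b opposite))
    (ind (wedge_vertices r (\<lambda>j. f j (b j)) ?V) (wedge_adjacent (\<lambda>j. f j (b j)) opposite))"
  proof (rule simplicial_iso_wedge[OF _ bV])
    show "bij_betw (f j) ?V ?V" for j
    proof (rule bij_betw_byWitness[of _ "f j"])
      show "\<forall>a\<in>?V. f j (f j a) = a" "\<forall>a\<in>?V. f j (f j a) = a" by (auto simp: f_def)
      show "f j ` ?V \<subseteq> ?V" "f j ` ?V \<subseteq> ?V"
        using bV[of j] by (auto simp: f_def swap_zero_def)
    qed
    have inj: "swap_zero a x = swap_zero a y \<longleftrightarrow> x = y" for a x y by (metis swap_zero_inverse)
    show "opposite u v \<longleftrightarrow> opposite (f j u) (f j v)" for j u v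
      by (cases u; cases v) (simp add: f_def opposite_def inj)
  qed
  have base: "f j (b j) = (0, 0)" if "j < r" for j
    using that by (cases "b j") (simp add: f_def swap_zero_def)
  have "ind (wedge_vertices r (\<lambda>j. f j (b j)) ?V) (wedge_adjacent (\<lambda>j. f j (b j)) opposite) =
      ind (wedge_vertices r (\<lambda>_. (0, 0)) ?V) (wedge_adjacent (\<lambda>_. (0, 0)) opposite)"
  proof (rule ind_cong)
    show "wedge_vertices r (\<lambda>j. f j (b j)) ?V = wedge_vertices r (\<lambda>_. (0, 0)) ?V"
      using base by (auto simp: wedge_vertices_def)
    fix u v assume "u \<in> wedge_vertices r (\<lambda>_. (0, 0)) ?V" "v \<in> wedge_vertices r (\<lambda>_. (0, 0)) ?V"
    then show "wedge_adjacent (\<lambda>j. f j (b j)) opposite u v = wedge_adjacent (\<lambda>_. (0, 0)) opposite u v"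
      using base by (auto simp: wedge_vertices_def)
  qed
  then have "wedge_type (ind (wedge_vertices r b ?V) (wedge_adjacent b opposite)) r d"
    using wedge_type_iso[OF simplicial_iso_sym[OF iso]] std by simp
  then show ?thesis
    unfolding diamond_ind by (simp only: wedge_copies_ind[OF assms(1) bV irrefl])
qed

lemma same_simple_homotopy_type_wedge_type:
  assumes "wedge_type K r d" "wedge_type L r d"
  shows "same_simple_homotopy_type K L"
  using same_simple_homotopy_type_trans[OF assms(1)[unfolded wedge_type_def]
      same_simple_homotopy_type_sym[OF assms(2)[unfolded wedge_type_def]]] .

lemma same_simple_homotopy_type_as_wedge_diamond:
  assumes "wedge_type K r d" "r \<ge> 1"
  shows "same_simple_homotopy_type_as_wedge K r (diamond d)"
  unfolding same_simple_homotopy_type_as_wedge_def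
  using same_simple_homotopy_type_wedge_type[OF assms(1) wedge_type_wedge_copies[OF assms(2)]]
  by simp

lemma same_simple_homotopy_type_diamond:
  assumes "wedge_type K 1 d"
  shows "same_simple_homotopy_type K (diamond d)"
  using same_simple_homotopy_type_wedge_type[OF assms wedge_type_diamond] .

section \<open>The certificates\<close>

text \<open>The moves were found by a randomized computer search, except for \<open>moebius_3_4\<close>. There the
  outer rows form an 8-cycle, and the moves turn the neighbourhoods of the four middle vertices
  into a common one whose complement spans two disjoint edges.\<close>

lemma moebius_2_1: "certifies_wedge
    []
    (cells 2 1) (band_edges 2 1 True) 1 0"
  by code_simp

text \<open>The closing edges are the two diagonals of the square, so the graph is already complete
  on four vertices.\<close>

lemma moebius_2_2: "certifies_wedge
    []
    (cells 2 2) (band_edges 2 2 True) 3 0"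
  by code_simp

lemma moebius_2_3: "certifies_wedge
    [Drop (2, 1) [] (1, 2), Drop (2, 3) [] (1, 2), Drop (2, 2) [] (1, 1), Drop (1, 3) [] (1, 1)]
    (cells 2 3) (band_edges 2 3 True) 1 0"
  by code_simp

lemma annulus_2_2: "certifies_wedge
    [Drop (1, 1) [] (2, 2), Drop (1, 2) [] (2, 1)]
    (cells 2 2) (band_edges 2 2 False) 1 0"
  by code_simp

lemma annulus_2_3: "certifies_wedge
    [Cut (2, 1) (2, 2) [] (1, 3), Drop (1, 3) [] (2, 1), Cut (2, 1) (2, 3) [] (1, 2),
     Drop (1, 2) [] (2, 1), Split (2, 2) (2, 3)]
    (cells 2 3) (band_edges 2 3 False) 1 1"
  by code_simp

text \<open>The middle row is fixed by the reversal, so its vertex carries a loop; the certificate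
  in the \<open>Drop\<close> is a mere placeholder.\<close>

lemma moebius_3_1: "certifies_wedge
    [Drop (2, 1) [] (1, 1)]
    (cells 3 1) (band_edges 3 1 True) 1 0"
  by code_simp

lemma moebius_3_2: "certifies_wedge
    [Drop (2, 1) [] (1, 2), Drop (3, 2) [] (1, 2), Drop (2, 2) [] (1, 1), Drop (1, 1) [] (3, 1)]
    (cells 3 2) (band_edges 3 2 True) 1 0"
  by code_simp

lemma moebius_3_3: "certifies_wedge
    [Cut (3, 1) (3, 2) [] (2, 3), Drop (2, 3) [] (3, 1), Cut (3, 1) (1, 3) [((3, 2), (1, 1))] (2, 2),
     Drop (2, 2) [] (3, 1), Drop (1, 1) [] (3, 1), Split (1, 2) (1, 3), Split (3, 2) (3, 3)]
    (cells 3 3) (band_edges 3 3 True) 1 2"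
  by code_simp

lemma moebius_3_4: "certifies_wedge
    [Join (2, 1) (2, 3) [] (1, 2), Join (2, 2) (2, 4) [] (1, 1), Join (2, 1) (1, 4) [] (1, 2),
     Join (2, 1) (3, 4) [] (3, 2), Join (2, 2) (1, 1) [] (3, 3), Join (2, 2) (3, 1) [] (1, 3),
     Cut (2, 2) (1, 2) [] (1, 4), Join (2, 2) (1, 4) [] (1, 2), Cut (2, 2) (3, 2) [] (3, 4),
     Join (2, 2) (3, 4) [] (3, 2), Join (2, 3) (1, 4) [] (3, 2), Cut (2, 3) (3, 3) [] (3, 1),
     Join (2, 3) (3, 1) [((3, 4), (1, 2))] (3, 3), Cut (2, 3) (1, 3) [((3, 3), (1, 1))] (3, 2),
     Join (2, 3) (1, 1) [] (1, 3), Join (2, 3) (3, 4) [] (3, 2), Join (2, 4) (1, 1) [] (1, 3),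
     Join (2, 4) (3, 1) [] (3, 3), Join (1, 1) (3, 1) [] (1, 3), Cut (1, 1) (1, 2) [] (1, 4),
     Drop (1, 4) [] (1, 2), Cut (3, 1) (3, 2) [] (3, 4), Cut (3, 3) (3, 4) [] (3, 1),
     Drop (3, 4) [] (3, 1), Split (1, 2) (1, 3), Split (3, 2) (3, 3)]
    (cells 3 4) (band_edges 3 4 True) 5 2"
  by code_simp

lemma moebius_3_5: "certifies_wedge
    [Drop (3, 1) [((1, 3), (2, 2)), ((2, 4), (3, 3))] (1, 4),
     Drop (3, 2) [((3, 5), (2, 1)), ((1, 4), (2, 3)), ((2, 3), (3, 4)), ((1, 1), (1, 3)), ((2, 4), (2, 1))] (3, 4),
     Drop (2, 2) [((3, 4), (1, 1))] (3, 3), Drop (3, 5) [] (2, 1), Drop (2, 1) [((1, 4), (1, 2))] (1, 5),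
     Drop (1, 1) [((2, 4), (1, 3)), ((2, 3), (3, 4)), ((1, 5), (1, 3))] (2, 5), Drop (1, 4) [] (1, 2),
     Drop (2, 4) [] (3, 3), Drop (2, 3) [] (1, 2), Split (3, 3) (3, 4), Split (1, 5) (2, 5)]
    (cells 3 5) (band_edges 3 5 True) 1 2"
  by code_simp

lemma annulus_3_2: "certifies_wedge
    [Drop (2, 1) [] (1, 2), Drop (2, 2) [] (1, 1), Split (3, 1) (3, 2)]
    (cells 3 2) (band_edges 3 2 False) 1 1"
  by code_simp

lemma annulus_3_3: "certifies_wedge
    [Drop (3, 1) [((1, 3), (2, 2)), ((2, 2), (1, 1))] (2, 3),
     Drop (3, 2) [((1, 3), (2, 1)), ((2, 1), (1, 2))] (2, 3), Drop (2, 2) [] (3, 3), Drop (2, 1) [] (3, 3),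
     Drop (1, 3) [] (3, 3), Split (2, 3) (3, 3)]
    (cells 3 3) (band_edges 3 3 False) 1 1"
  by code_simp

text \<open>The two joins add the diagonals of the square on \<open>(1, 1)\<close>,
  \<open>(1, 2)\<close>, \<open>(2, 1)\<close>, \<open>(2, 2)\<close>. The resulting complete graph
  is what remains at the end, whence three spheres.\<close>

lemma annulus_3_4: "certifies_wedge
    [Cut (2, 1) (3, 1) [((2, 3), (1, 2))] (3, 3), Drop (3, 3) [] (3, 1),
     Cut (2, 2) (3, 2) [((2, 4), (1, 1))] (3, 4), Drop (3, 4) [] (3, 2), Join (1, 1) (2, 2) [] (1, 3),
     Cut (2, 2) (2, 3) [] (1, 4), Drop (1, 4) [] (2, 3), Join (2, 1) (1, 2) [] (2, 3),
     Cut (2, 1) (2, 4) [] (1, 3), Drop (1, 3) [] (2, 4), Split (3, 1) (3, 2), Split (2, 3) (2, 4)]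
    (cells 3 4) (band_edges 3 4 False) 3 2"
  by code_simp

lemma annulus_3_5: "certifies_wedge
    [Drop (2, 5) [((1, 3), (1, 1))] (1, 4), Drop (2, 2) [((1, 4), (1, 1))] (1, 3),
     Drop (2, 3) [((1, 5), (1, 2))] (1, 4), Drop (2, 1) [((1, 4), (1, 2))] (1, 5),
     Drop (2, 4) [((1, 1), (1, 3))] (1, 5), Cut (1, 2) (1, 3) [] (1, 5), Drop (1, 5) [] (1, 2),
     Cut (3, 3) (3, 4) [] (3, 1), Drop (3, 1) [] (3, 3), Split (3, 2) (3, 3), Split (1, 3) (1, 4),
     Split (3, 4) (3, 5)]
    (cells 3 5) (band_edges 3 5 False) 1 3"
  by code_simp

text \<open>The joins are the two crossed edges, and the four cuts separate the inner square from
  the border columns; dropping one of its columns leaves a single edge.\<close>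

definition window_moves_2 :: "(nat \<times> nat) move list" where
  "window_moves_2 =
    [Join (1, 1) (2, 4) [] (2, 2), Join (2, 1) (1, 4) [] (1, 2), Cut (1, 4) (1, 3) [] (2, 2),
     Cut (2, 1) (2, 2) [] (1, 3), Cut (2, 4) (2, 3) [] (1, 2), Cut (1, 1) (1, 2) [] (2, 3),
     Drop (2, 3) [] (1, 2), Drop (1, 3) [] (2, 2), Split (1, 2) (2, 2)]"

lemma run_window_moves_2:
  "run window_moves_2 (inner_cells 2 2, path_edges 2 (2 + 2)) = Some ([], crossed_edges 2 (2 + 2))"
  "length (filter is_split window_moves_2) = 1"
  by code_simp+

definition window_moves_3 :: "(nat \<times> nat) move list" where
  "window_moves_3 =
    [Join (1, 1) (3, 6) [((3, 3), (2, 2)), ((2, 4), (1, 3))] (3, 4),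
     Join (2, 1) (2, 6) [((1, 4), (1, 2))] (1, 5),
     Join (3, 1) (1, 6) [((1, 3), (2, 2)), ((2, 4), (3, 3))] (1, 4),
     Cut (1, 6) (1, 5) [((2, 3), (3, 2)), ((2, 2), (1, 3)), ((3, 4), (3, 2))] (2, 4),
     Cut (2, 6) (2, 5) [((1, 2), (1, 4)), ((3, 3), (2, 2))] (3, 4),
     Cut (1, 1) (1, 2) [((3, 4), (2, 3)), ((2, 5), (1, 4))] (3, 5),
     Cut (2, 1) (2, 2) [((2, 4), (1, 3)), ((1, 5), (1, 3)), ((3, 5), (3, 3))] (2, 5),
     Cut (3, 1) (3, 2) [((1, 4), (1, 2)), ((2, 5), (3, 4))] (1, 5),
     Cut (3, 6) (3, 5) [((2, 3), (1, 2)), ((2, 2), (3, 3)), ((1, 4), (1, 2))] (2, 4),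
     Drop (2, 2) [((2, 4), (1, 3)), ((1, 5), (1, 3)), ((3, 5), (3, 3))] (2, 5),
     Drop (1, 2) [((3, 4), (3, 2)), ((2, 5), (1, 4))] (3, 5), Drop (1, 5) [((2, 3), (3, 2))] (1, 3),
     Drop (2, 4) [] (1, 3), Drop (2, 3) [] (3, 2), Drop (3, 4) [] (3, 2), Split (3, 2) (3, 3),
     Split (1, 3) (1, 4), Split (2, 5) (3, 5)]"

lemma run_window_moves_3:
  "run window_moves_3 (inner_cells 3 4, path_edges 3 (4 + 2)) = Some ([], crossed_edges 3 (4 + 2))"
  "length (filter is_split window_moves_3) = 3"
  by code_simp+

section \<open>Periodicity\<close>

definition band_type :: "nat \<Rightarrow> nat \<Rightarrow> bool \<Rightarrow> nat \<Rightarrow> nat \<Rightarrow> bool" where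
  "band_type m n t r d \<longleftrightarrow>
    wedge_type (ind ({1..m} \<times> {1..n}) (linked (band_edges m n t))) r d"

lemma band_type_certificate:
  "certifies_wedge mvs (cells m n) (band_edges m n t) r d \<Longrightarrow> band_type m n t r d"
  unfolding band_type_def set_cells[symmetric] by (rule certifies_wedge)

lemma band_type_2_shorten: "n \<ge> 2 \<Longrightarrow> band_type 2 n (\<not> t) r d \<Longrightarrow> band_type 2 (n + 2) t r (d + 1)"
  using wedge_type_shorten_band[OF run_window_moves_2(1), of n t r d]
  by (simp add: band_type_def run_window_moves_2(2))

lemma band_type_3_shorten: "n \<ge> 2 \<Longrightarrow> band_type 3 n (\<not> t) r d \<Longrightarrow> band_type 3 (n + 4) t r (d + 3)"
  using wedge_type_shorten_band[OF run_window_moves_3(1), of n t r d]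
  by (simp add: band_type_def run_window_moves_3(2))

lemma band_type_2_period:
  assumes "band_type 2 n True r d" "n \<ge> 2"
  shows "band_type 2 (4 * k + n) True r (2 * k + d)"
proof (induction k)
  case (Suc k)
  have "band_type 2 (4 * k + n + 2) False r (2 * k + d + 1)"
    using Suc assms(2) by - (rule band_type_2_shorten, simp_all)
  then have "band_type 2 (4 * k + n + 2 + 2) True r (2 * k + d + 1 + 1)"
    by - (rule band_type_2_shorten, simp_all)
  moreover have "4 * Suc k + n = 4 * k + n + 2 + 2" "2 * Suc k + d = 2 * k + d + 1 + 1" by simp_all
  ultimately show ?case by (simp only:)
qed (use assms in simp)

lemma band_type_3_period:
  assumes "band_type 3 n True r d" "n \<ge> 2"
  shows "band_type 3 (8 * k + n) True r (6 * k + d)"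
proof (induction k)
  case (Suc k)
  have "band_type 3 (8 * k + n + 4) False r (6 * k + d + 3)"
    using Suc assms(2) by - (rule band_type_3_shorten, simp_all)
  then have "band_type 3 (8 * k + n + 4 + 4) True r (6 * k + d + 3 + 3)"
    by - (rule band_type_3_shorten, simp_all)
  moreover have "8 * Suc k + n = 8 * k + n + 4 + 4" "6 * Suc k + d = 6 * k + d + 3 + 3" by simp_all
  ultimately show ?case by (simp only:)
qed (use assms in simp)

text \<open>The lengths 4 and 5 come from annuli of length 2 and 3. Length 5 is needed because the
  periodicity cannot start from a single column.\<close>

lemma band_type_2_initial:
  "band_type 2 1 True 1 0" "band_type 2 2 True 3 0" "band_type 2 3 True 1 0"
  "band_type 2 4 True 1 1" "band_type 2 5 True 1 2"
proof -
  show "band_type 2 1 True 1 0" "band_type 2 2 True 3 0" "band_type 2 3 True 1 0"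
    by (rule band_type_certificate, rule moebius_2_1 moebius_2_2 moebius_2_3)+
  have "band_type 2 2 False 1 0" "band_type 2 3 False 1 1"
    by (rule band_type_certificate, rule annulus_2_2 annulus_2_3)+
  then show "band_type 2 4 True 1 1" "band_type 2 5 True 1 2"
    using band_type_2_shorten[of 2 True 1 0] band_type_2_shorten[of 3 True 1 1]
    by (simp_all add: eval_nat_numeral)
qed

text \<open>The lengths 6 to 9 come from annuli of length 2 to 5 at the cost of three suspensions;
  length 9 starts the residue class of 1.\<close>

lemma band_type_3_initial:
  "band_type 3 1 True 1 0" "band_type 3 2 True 1 0" "band_type 3 3 True 1 2"
  "band_type 3 4 True 5 2" "band_type 3 5 True 1 2" "band_type 3 6 True 1 4"
  "band_type 3 7 True 1 4" "band_type 3 8 True 3 5" "band_type 3 9 True 1 6"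
proof -
  show "band_type 3 1 True 1 0" "band_type 3 2 True 1 0" "band_type 3 3 True 1 2"
    "band_type 3 4 True 5 2" "band_type 3 5 True 1 2"
    by (rule band_type_certificate,
        rule moebius_3_1 moebius_3_2 moebius_3_3 moebius_3_4 moebius_3_5)+
  have "band_type 3 2 False 1 1" "band_type 3 3 False 1 1" "band_type 3 4 False 3 2"
    "band_type 3 5 False 1 3"
    by (rule band_type_certificate, rule annulus_3_2 annulus_3_3 annulus_3_4 annulus_3_5)+
  then show "band_type 3 6 True 1 4" "band_type 3 7 True 1 4" "band_type 3 8 True 3 5"
    "band_type 3 9 True 1 6"
    using band_type_3_shorten[of 2 True 1 1] band_type_3_shorten[of 3 True 1 1]
      band_type_3_shorten[of 4 True 3 2] band_type_3_shorten[of 5 True 1 3] by simp_all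
qed

text \<open>Writing the residue 0 as \<open>4 * k + 4\<close> avoids the dimension
  \<open>2 * k - 1\<close>, where subtraction on \<open>nat\<close> truncates for
  \<open>k = 0\<close>.\<close>

lemma band_type_2:
  "band_type 2 (4 * k + 1) True 1 (2 * k)"
  "band_type 2 (4 * k + 2) True 3 (2 * k)"
  "band_type 2 (4 * k + 3) True 1 (2 * k)"
  "band_type 2 (4 * k + 4) True 1 (2 * k + 1)"
proof -
  show "band_type 2 (4 * k + 1) True 1 (2 * k)"
  proof (cases k)
    case 0
    then show ?thesis using band_type_2_initial(1) by simp
  next
    case (Suc l)
    then show ?thesis
      using band_type_2_period[OF band_type_2_initial(5), of l] by (simp add: add.commute)
  qed
qed (use band_type_2_period[OF band_type_2_initial(2), of k]
    band_type_2_period[OF band_type_2_initial(3), of k]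
    band_type_2_period[OF band_type_2_initial(4), of k] in simp_all)

lemma band_type_3:
  "band_type 3 (8 * k + 1) True 1 (6 * k)"
  "band_type 3 (8 * k + 2) True 1 (6 * k)"
  "band_type 3 (8 * k + 3) True 1 (6 * k + 2)"
  "band_type 3 (8 * k + 4) True 5 (6 * k + 2)"
  "band_type 3 (8 * k + 5) True 1 (6 * k + 2)"
  "band_type 3 (8 * k + 6) True 1 (6 * k + 4)"
  "band_type 3 (8 * k + 7) True 1 (6 * k + 4)"
  "band_type 3 (8 * k + 8) True 3 (6 * k + 5)"
proof -
  show "band_type 3 (8 * k + 1) True 1 (6 * k)"
  proof (cases k)
    case 0
    then show ?thesis using band_type_3_initial(1) by simp
  next
    case (Suc l)
    then show ?thesis
      using band_type_3_period[OF band_type_3_initial(9), of l] by (simp add: add.commute)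
  qed
qed (use band_type_3_initial(2-8)[THEN band_type_3_period, of k] in simp_all)

lemma moebius_grid_diamond:
  assumes "band_type m n True 1 d" "n \<ge> 1"
  shows "same_simple_homotopy_type (independence_complex (moebius_grid m n)) (diamond d)"
  using assms unfolding band_type_def
  by (intro same_simple_homotopy_type_diamond wedge_type_moebius_grid)

lemma moebius_grid_wedge:
  assumes "band_type m n True r d" "n \<ge> 1" "r \<ge> 1"
  shows "same_simple_homotopy_type_as_wedge (independence_complex (moebius_grid m n)) r (diamond d)"
  using assms unfolding band_type_def
  by (intro same_simple_homotopy_type_as_wedge_diamond wedge_type_moebius_grid)

lemma moebius_grid_2:
  assumes "4 * k + i \<ge> 1"
  shows "i = 0 \<Longrightarrow> same_simple_homotopy_type
      (independence_complex (moebius_grid 2 (4 * k + i))) (diamond (2 * k - 1))"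
    "i = 1 \<Longrightarrow> same_simple_homotopy_type
      (independence_complex (moebius_grid 2 (4 * k + i))) (diamond (2 * k))"
    "i = 2 \<Longrightarrow> same_simple_homotopy_type_as_wedge
      (independence_complex (moebius_grid 2 (4 * k + i))) 3 (diamond (2 * k))"
    "i = 3 \<Longrightarrow> same_simple_homotopy_type
      (independence_complex (moebius_grid 2 (4 * k + i))) (diamond (2 * k))"
proof -
  assume i: "i = 0"
  \<comment> \<open>For \<open>i = 0\<close> the assumption forces \<open>k \<ge> 1\<close>, so
    \<open>2 * k - 1\<close> is a genuine difference.\<close>
  then obtain l where "k = Suc l" using assms by (cases k) auto
  then have "4 * k + i = 4 * l + 4" "2 * k - 1 = 2 * l + 1" using i by simp_all
  then show "same_simple_homotopy_type
      (independence_complex (moebius_grid 2 (4 * k + i))) (diamond (2 * k - 1))"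
    using moebius_grid_diamond[OF band_type_2(4)[of l]] by simp
qed (use band_type_2[of k] in \<open>auto intro: moebius_grid_diamond moebius_grid_wedge\<close>)

lemma moebius_grid_3:
  assumes "8 * k + i \<ge> 1"
  shows "i = 0 \<Longrightarrow> same_simple_homotopy_type_as_wedge
      (independence_complex (moebius_grid 3 (8 * k + i))) 3 (diamond (6 * k - 1))"
    "i \<in> {1, 2} \<Longrightarrow> same_simple_homotopy_type
      (independence_complex (moebius_grid 3 (8 * k + i))) (diamond (6 * k))"
    "i = 3 \<Longrightarrow> same_simple_homotopy_type
      (independence_complex (moebius_grid 3 (8 * k + i))) (diamond (6 * k + 2))"
    "i = 4 \<Longrightarrow> same_simple_homotopy_type_as_wedge
      (independence_complex (moebius_grid 3 (8 * k + i))) 5 (diamond (6 * k + 2))"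
    "i = 5 \<Longrightarrow> same_simple_homotopy_type
      (independence_complex (moebius_grid 3 (8 * k + i))) (diamond (6 * k + 2))"
    "i \<in> {6, 7} \<Longrightarrow> same_simple_homotopy_type
      (independence_complex (moebius_grid 3 (8 * k + i))) (diamond (6 * k + 4))"
proof -
  assume i: "i = 0"
  then obtain l where "k = Suc l" using assms by (cases k) auto
  then have "8 * k + i = 8 * l + 8" "6 * k - 1 = 6 * l + 5" using i by simp_all
  then show "same_simple_homotopy_type_as_wedge
      (independence_complex (moebius_grid 3 (8 * k + i))) 3 (diamond (6 * k - 1))"
    using moebius_grid_wedge[OF band_type_3(8)[of l]] by simp
qed (use band_type_3[of k] in \<open>auto intro: moebius_grid_diamond moebius_grid_wedge\<close>)

theorem corollary1p6:
  shows
    "(\<forall>k i :: nat. i \<in> {0, 1, 2, 3} \<and> 4 * k + i \<ge> 1 \<longrightarrow>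
       (let I = independence_complex (moebius_grid 2 (4 * k + i)) in
         (i = 0 \<longrightarrow> same_simple_homotopy_type I (diamond (2 * k - 1))) \<and>
         (i = 1 \<longrightarrow> same_simple_homotopy_type I (diamond (2 * k))) \<and>
         (i = 2 \<longrightarrow> same_simple_homotopy_type_as_wedge I 3 (diamond (2 * k))) \<and>
         (i = 3 \<longrightarrow> same_simple_homotopy_type I (diamond (2 * k))))) \<and>
     (\<forall>k i :: nat. i \<in> {0..7} \<and> 8 * k + i \<ge> 1 \<longrightarrow>
       (let I = independence_complex (moebius_grid 3 (8 * k + i)) in
         (i = 0 \<longrightarrow> same_simple_homotopy_type_as_wedge I 3 (diamond (6 * k - 1))) \<and>
         (i \<in> {1, 2} \<longrightarrow> same_simple_homotopy_type I (diamond (6 * k))) \<and>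
         (i = 3 \<longrightarrow> same_simple_homotopy_type I (diamond (6 * k + 2))) \<and>
         (i = 4 \<longrightarrow> same_simple_homotopy_type_as_wedge I 5 (diamond (6 * k + 2))) \<and>
         (i = 5 \<longrightarrow> same_simple_homotopy_type I (diamond (6 * k + 2))) \<and>
         (i \<in> {6, 7} \<longrightarrow> same_simple_homotopy_type I (diamond (6 * k + 4)))))"
  unfolding Let_def using moebius_grid_2 moebius_grid_3 by blast

end
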